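(* Every planar graph with girth at least $11$ is odd $4$-colorable.
   Context: All graphs are finite and simple (no loops, no parallel edges). The girth of a graph is the length of its shortest cycle (infinite if it has no cycle). An odd $c$-coloring of a graph is a proper coloring of its vertices with (at most) $c$ colors such that, for each vertex $v$ of positive degree, some color appears an odd number of times on the neighborhood of $v$. A graph is odd $c$-colorable if it has an odd $c$-coloring. *)

theory Defs
  imports "HOL-Analysis.Analysis" "HOL-Library.Extended_Nat"
begin

text \<open>
  A finite simple graph is given by its vertex set \<open>V\<close> and its set \<open>E\<close> of edges, each edge being
  a two-element subset of \<open>V\<close>.
\<close>

definition simple_graph :: "'a set \<Rightarrow> 'a set set \<Rightarrow> bool" where
  "simple_graph V E \<longleftrightarrow> finite V \<and> (\<forall>e\<in>E. e \<subseteq> V \<and> card e = 2)"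

definition neighborhood :: "'a set set \<Rightarrow> 'a \<Rightarrow> 'a set" where
  "neighborhood E v = {u. {v, u} \<in> E}"

text \<open>A cycle is listed by its vertices in cyclic order, without repeating the first one.\<close>

definition is_cycle :: "'a set set \<Rightarrow> 'a list \<Rightarrow> bool" where
  "is_cycle E vs \<longleftrightarrow> 3 \<le> length vs \<and> distinct vs \<and>
     (\<forall>i<length vs. {vs ! i, vs ! (Suc i mod length vs)} \<in> E)"

text \<open>For an acyclic graph this is the infimum of the empty set, which is \<open>\<infinity>\<close>.\<close>

definition girth :: "'a set set \<Rightarrow> enat" where
  "girth E = Inf {enat (length vs) | vs. is_cycle E vs}"

text \<open>
  Drawings in the plane, identified with the complex numbers: vertices are distinct points, edges
  are simple arcs (continuous, not necessarily polygonal) joining their ends. An arc passes through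
  no vertex other than its ends, and distinct arcs meet only in common ends.
\<close>

definition plane_drawing ::
  "'a set \<Rightarrow> 'a set set \<Rightarrow> ('a \<Rightarrow> complex) \<Rightarrow> ('a set \<Rightarrow> real \<Rightarrow> complex) \<Rightarrow> bool" where
  "plane_drawing V E p \<gamma> \<longleftrightarrow>
     inj_on p V \<and>
     (\<forall>e\<in>E. arc (\<gamma> e) \<and> {pathstart (\<gamma> e), pathfinish (\<gamma> e)} = p ` e \<and>
        path_image (\<gamma> e) \<inter> p ` V = p ` e) \<and>
     (\<forall>e\<in>E. \<forall>e'\<in>E. e \<noteq> e' \<longrightarrow> path_image (\<gamma> e) \<inter> path_image (\<gamma> e') = p ` (e \<inter> e'))"

definition planar :: "'a set \<Rightarrow> 'a set set \<Rightarrow> bool" where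
  "planar V E \<longleftrightarrow> (\<exists>p \<gamma>. plane_drawing V E p \<gamma>)"

definition proper_coloring :: "'a set \<Rightarrow> 'a set set \<Rightarrow> nat \<Rightarrow> ('a \<Rightarrow> nat) \<Rightarrow> bool" where
  "proper_coloring V E c f \<longleftrightarrow> f ` V \<subseteq> {..<c} \<and> (\<forall>u v. {u, v} \<in> E \<longrightarrow> f u \<noteq> f v)"

definition odd_coloring :: "'a set \<Rightarrow> 'a set set \<Rightarrow> nat \<Rightarrow> ('a \<Rightarrow> nat) \<Rightarrow> bool" where
  "odd_coloring V E c f \<longleftrightarrow> proper_coloring V E c f \<and>
     (\<forall>v\<in>V. card (neighborhood E v) > 0 \<longrightarrow>
        (\<exists>k. odd (card {u \<in> neighborhood E v. f u = k})))"

definition odd_colorable :: "'a set \<Rightarrow> 'a set set \<Rightarrow> nat \<Rightarrow> bool" where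
  "odd_colorable V E c \<longleftrightarrow> (\<exists>f. odd_coloring V E c f)"

end

theory Submission
  imports Defs
begin

text \<open>
  Planarity enters only through the inequality \<open>9 |E| < 11 |V|\<close>, proved without the full Euler
  formula. Adding an edge that closes a cycle creates a new face (Jordan curve theorem), and an
  acyclic graph has at most \<open>|V|\<close> edges, so there are at least \<open>|E| + 1 - |V|\<close> faces. The edges on
  the boundary of a face contain a cycle unless the graph is a forest, and an edge on a cycle bounds
  at most two faces (Janiszewski's theorem), so \<open>11\<close> times the number of faces is at most \<open>2 |E|\<close>.

  In a vertex-minimal counterexample, remove a vertex \<open>v\<close> together with threads of 2-vertices
  leaving it, and color the rest. For a suitable new color of \<open>v\<close> the threads can be recolored,
  unless few 2-vertices lie on threads at \<open>v\<close>. Give each vertex of degree \<open>d\<close> the charge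
  \<open>9 d - 22\<close>, with negative total, and let every vertex of degree other than 2 pay \<open>2\<close> to each
  2-vertex on its threads: every 2-vertex is paid twice, ends with charge \<open>0\<close>, and no other vertex
  becomes negative, a contradiction.
\<close>

subsection \<open>Arcs closing a Jordan curve\<close>

text \<open>The main obstacle is a kept vertex of even degree, which can lose its odd color once a
  removed neighbor is colored. Fixing one odd color \<open>d u\<close> at each kept vertex makes
  this local: the last vertex before the end of a thread must avoid it. Ends of odd degree are safe
  by parity. A thread without 2-vertices then forbids at most two colors of the center, one with a
  single 2-vertex at most one, longer ones none; four colors afford a total of three. A center of
  positive even degree also needs an odd class of its own, and gets it from a thread whose first
  color can be switched.

  The charges sum to 18|E| - 22|V|, twice the difference in the inequality; a 2-vertex has charge
  -4, hence the payment 2 from either side. Girth 11 enters as this density. The recoloring itself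
  only needs that two threads of at most four edges leaving v do not meet, so cycles of length at
  least 9 suffice there.

  Faces are counted through finite families, and only edges on cycles are charged to them, so
  disconnected graphs and bridges call for no separate treatment.\<close>

lemma arc_interior_nonempty:
  assumes "arc g"
  shows "path_image g - {pathstart g, pathfinish g} \<noteq> {}"
proof -
  have "inj_on g {0..1}" using assms by (simp add: arc_def)
  then have "g (1/2) \<noteq> g 0" "g (1/2) \<noteq> g 1" by (auto dest: inj_onD)
  moreover have "g (1/2) \<in> path_image g" unfolding path_image_def by (rule imageI) simp
  ultimately show ?thesis by (auto simp: pathstart_def pathfinish_def)
qed

text \<open>A small ball around \<open>z\<close> misses \<open>K\<close> and contains a point of
  \<open>C\<close>, and the open arc is connected and misses \<open>K\<close>. So every region
  touching the open arc reaches the same fixed point \<open>m\<close> off \<open>K\<close>, which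
  prepares for Janiszewski's theorem.\<close>

lemma edge_frontier_connected:
  fixes g :: "real \<Rightarrow> complex"
  assumes "arc g" "closed K" "path_image g \<inter> K = {pathstart g, pathfinish g}"
    and m: "m \<in> path_image g - {pathstart g, pathfinish g}"
    and "z \<in> path_image g - {pathstart g, pathfinish g}" "z \<in> closure C"
  obtains x where "x \<in> C" "connected_component (- K) x m"
proof -
  have "z \<in> - K" "open (- K)" using assms by auto
  then obtain e where e: "e > 0" "ball z e \<subseteq> - K" by (auto simp: open_contains_ball)
  from \<open>z \<in> closure C\<close> e(1) obtain x where x: "x \<in> C" "dist x z < e"
    by (auto simp: closure_approachable)
  have "connected_component (- K) x z"
    unfolding connected_component_def using e x
    by (intro exI[of _ "ball z e"]) (auto simp: dist_commute)
  moreover have "connected_component (- K) z m"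
    unfolding connected_component_def
    using connected_simple_path_endless[OF arc_imp_simple_path[OF assms(1)]] assms
    by (intro exI[of _ "path_image g - {pathstart g, pathfinish g}"]) auto
  ultimately show ?thesis using x that connected_component_trans by blast
qed

text \<open>In the application \<open>K\<close> is the drawing without one edge, \<open>g\<close> is
  that edge, and \<open>h\<close> is a path of other edges joining its ends. \<open>K\<close> may
  contain much more than \<open>h\<close>, so each side of the Jordan curve may fall into many
  components.\<close>

locale closing_arc =
  fixes g h :: "real \<Rightarrow> complex" and K :: "complex set"
  assumes g: "arc g" and h: "arc h"
    and ends: "pathfinish g = pathstart h" "pathfinish h = pathstart g"
    and K: "compact K" and gK: "path_image g \<inter> K = {pathstart g, pathfinish g}"
    and hK: "path_image h \<subseteq> K"
begin

abbreviation "J \<equiv> path_image (g +++ h)"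
abbreviation "ends \<equiv> {pathstart g, pathfinish g}"

lemma J: "J = path_image g \<union> path_image h"
  using ends by (simp add: path_image_join)

lemma gh: "path_image g \<inter> path_image h = ends"
  using gK hK ends pathstart_in_path_image[of h] pathfinish_in_path_image[of h] by auto

lemma simple: "simple_path (g +++ h)" "pathfinish (g +++ h) = pathstart (g +++ h)"
  using simple_path_join_loop[OF g h] ends gh by auto

lemma sides:
  "open (inside J)" "open (outside J)" "connected (inside J)" "connected (outside J)"
  "inside J \<inter> outside J = {}" "inside J \<union> outside J = - J"
  "frontier (inside J) = J" "frontier (outside J) = J"
  using Jordan_inside_outside[OF simple] by simp_all

lemma JK: "J \<inter> K = path_image h"
proof -
  have "ends \<subseteq> path_image h"
    using ends pathstart_in_path_image[of h] pathfinish_in_path_image[of h] by auto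
  then have "path_image g \<inter> K \<subseteq> path_image h" using gK by simp
  then show ?thesis using J hK by blast
qed

lemma closedK: "closed K"
  using K by (rule compact_imp_closed)

lemma compactJ: "compact J"
  using simple(1) by (simp add: compact_simple_path_image)

text \<open>Points near the arc on the same side of \<open>J\<close> are joined off \<open>J\<close> and off \<open>K\<close>, and
  \<open>J \<inter> K\<close> is the connected set \<open>path_image h\<close>, so Janiszewski's theorem joins them
  off \<open>J \<union> K\<close>.\<close>

lemma same_side:
  assumes "C1 \<in> components (- (K \<union> path_image g))" "C2 \<in> components (- (K \<union> path_image g))"
    and "closure C1 \<inter> (path_image g - ends) \<noteq> {}" "closure C2 \<inter> (path_image g - ends) \<noteq> {}"
    and "connected S" "S \<subseteq> - J" "C1 \<subseteq> S" "C2 \<subseteq> S"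
  shows "C1 = C2"
proof -
  obtain m where m: "m \<in> path_image g - ends" using arc_interior_nonempty[OF g] by auto
  obtain x1 where x1: "x1 \<in> C1" "connected_component (- K) x1 m"
    using edge_frontier_connected[OF g closedK gK m] assms(3) by blast
  obtain x2 where x2: "x2 \<in> C2" "connected_component (- K) x2 m"
    using edge_frontier_connected[OF g closedK gK m] assms(4) by blast
  have "connected_component (- K) x1 x2"
    using x1 x2 connected_component_sym connected_component_trans by blast
  moreover have "connected_component (- J) x1 x2"
    unfolding connected_component_def using assms x1 x2 by blast
  moreover have "connected (J \<inter> K)"
    unfolding JK by (simp add: arc_imp_path connected_path_image h)
  ultimately have "connected_component (- (J \<union> K)) x1 x2"
    using Janiszewski compactJ closedK by blast
  moreover have "J \<union> K = K \<union> path_image g" using J hK by auto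
  ultimately have "connected_component (- (K \<union> path_image g)) x1 x2" by simp
  then obtain T where "connected T" "T \<subseteq> - (K \<union> path_image g)" "x1 \<in> T" "x2 \<in> T"
    unfolding connected_component_def by blast
  moreover from this have "T \<subseteq> C1" "T \<subseteq> C2"
    using components_maximal[OF assms(1)] components_maximal[OF assms(2)] x1(1) x2(1) by blast+
  ultimately show ?thesis
    using components_nonoverlap[OF assms(1,2)] by blast
qed

lemma component_side:
  assumes "C \<in> components (- (K \<union> path_image g))"
  shows "C \<subseteq> inside J \<or> C \<subseteq> outside J"
proof -
  have "connected C" "C \<subseteq> - (K \<union> path_image g)"
    using in_components_connected[OF assms] in_components_subset[OF assms] by blast+
  moreover have "- (K \<union> path_image g) \<subseteq> - J" using J hK by auto
  ultimately have "C \<subseteq> inside J \<union> outside J" using sides(6) by blast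
  with connectedD[OF \<open>connected C\<close> sides(1,2)] sides(5) show ?thesis by blast
qed

text \<open>Each component lies on one side of \<open>J\<close>, and \<open>same_side\<close> leaves
  room for one per side.\<close>

lemma at_most_two_sides:
  assumes "\<And>C. C \<in> \<Phi> \<Longrightarrow> C \<in> components (- (K \<union> path_image g))"
    and "\<And>C. C \<in> \<Phi> \<Longrightarrow> closure C \<inter> (path_image g - ends) \<noteq> {}"
  shows "card \<Phi> \<le> 2"
proof -
  have side: "card {C \<in> \<Phi>. C \<subseteq> S} \<le> 1" if "connected S" "S \<subseteq> - J" for S
  proof -
    have "C1 = C2" if "C1 \<in> {C \<in> \<Phi>. C \<subseteq> S}" "C2 \<in> {C \<in> \<Phi>. C \<subseteq> S}" for C1 C2
      using that assms \<open>connected S\<close> \<open>S \<subseteq> - J\<close> by (intro same_side[of C1 C2 S]) auto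
    then have "{C \<in> \<Phi>. C \<subseteq> S} = {} \<or> (\<exists>C. {C \<in> \<Phi>. C \<subseteq> S} = {C})" by blast
    then show ?thesis by (metis card.empty card.insert empty_iff finite.emptyI le_numeral_extra(4)
        One_nat_def zero_le)
  qed
  have "card {C \<in> \<Phi>. C \<subseteq> inside J} \<le> 1" "card {C \<in> \<Phi>. C \<subseteq> outside J} \<le> 1"
    using side[OF sides(3)] side[OF sides(4)] sides(6) by blast+
  moreover have "\<Phi> = {C \<in> \<Phi>. C \<subseteq> inside J} \<union> {C \<in> \<Phi>. C \<subseteq> outside J}"
    using component_side assms by blast
  ultimately show ?thesis
    using card_Un_le[of "{C \<in> \<Phi>. C \<subseteq> inside J}" "{C \<in> \<Phi>. C \<subseteq> outside J}"] by simp
qed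

text \<open>The component \<open>W\<close> of \<open>- K\<close> that contains the open arc splits:
  both sides of \<open>J\<close> accumulate at \<open>m\<close>, and no new component crosses
  \<open>J\<close>. All other components survive, so replacing \<open>W\<close> by \<open>X\<close>
  and \<open>Y\<close> gains at least one. Finite families stand in for the whole set of components,
  whose finiteness is not established.\<close>

lemma more_components:
  assumes "finite \<Phi>" "\<Phi> \<subseteq> components (- K)"
  obtains \<Phi>' where "finite \<Phi>'" "\<Phi>' \<subseteq> components (- (K \<union> path_image g))"
    "card \<Phi>' \<ge> Suc (card \<Phi>)"
proof -
  let ?D = "K \<union> path_image g"
  obtain m where m: "m \<in> path_image g - ends" using arc_interior_nonempty[OF g] by auto
  have mK: "m \<in> - K" using m gK by auto
  define W where "W = connected_component_set (- K) m"
  have mJ: "m \<in> frontier (inside J)" "m \<in> frontier (outside J)" using sides J m by auto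
  have near: "\<exists>x \<in> X - ?D. connected_component (- K) x m"
    if "m \<in> frontier X" "X \<inter> J = {}" for X
  proof -
    obtain e where e: "e > 0" "ball m e \<subseteq> - K"
      using mK closedK by (metis open_Compl open_contains_ball)
    have "m \<in> closure X" using that(1) by (simp add: frontier_def)
    then obtain x where x: "x \<in> X" "dist x m < e"
      using e(1) unfolding closure_approachable by blast
    have "connected_component (- K) x m"
      unfolding connected_component_def using e x
      by (intro exI[of _ "ball m e"]) (auto simp: dist_commute)
    moreover have "x \<notin> ?D" using x e that J by (auto simp: dist_commute)
    ultimately show ?thesis using x by blast
  qed
  obtain x where x: "x \<in> inside J - ?D" "connected_component (- K) x m"
    using near[OF mJ(1)] inside_no_overlap[of J] by auto
  obtain y where y: "y \<in> outside J - ?D" "connected_component (- K) y m"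
    using near[OF mJ(2)] outside_no_overlap[of J] by auto
  define X where "X = connected_component_set (- ?D) x"
  define Y where "Y = connected_component_set (- ?D) y"
  have XY: "X \<in> components (- ?D)" "Y \<in> components (- ?D)" "x \<in> X" "y \<in> Y"
    using x y by (auto simp: X_def Y_def components_iff)
  have "X \<noteq> Y"
    using component_side[OF XY(1)] sides(5) x(1) y(1) XY(3,4) by blast
  have W: "W \<in> components (- K)" using mK by (auto simp: W_def components_iff)
  have gW: "path_image g - ends \<subseteq> W"
    unfolding W_def
    by (rule connected_component_maximal[OF m connected_simple_path_endless])
      (use g gK arc_imp_simple_path in blast)+
  have xW: "x \<in> W" "y \<in> W"
    using x y by (auto simp: W_def connected_component_sym)
  have keep: "C \<in> components (- ?D)" if C: "C \<in> \<Phi> - {W}" for C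
  proof -
    have CK: "C \<in> components (- K)" using C assms by auto
    then have "C \<inter> W = {}" using components_nonoverlap[OF CK W] C by auto
    then have "C \<subseteq> - ?D" using gW gK in_components_subset[OF CK] by auto
    then show ?thesis
      using components_intermediate_subset[OF CK, of "- ?D"] by blast
  qed
  have disj: "X \<notin> \<Phi> - {W}" "Y \<notin> \<Phi> - {W}"
    using components_nonoverlap[OF _ W] assms(2) xW XY(3,4) by (metis DiffE disjoint_iff insertI1 subsetD)+
  let ?\<Phi>' = "insert X (insert Y (\<Phi> - {W}))"
  have "card ?\<Phi>' = Suc (Suc (card (\<Phi> - {W})))"
    using assms(1) disj \<open>X \<noteq> Y\<close> by simp
  then have "card ?\<Phi>' \<ge> Suc (card \<Phi>)"
    using assms(1) by (cases "W \<in> \<Phi>") (auto simp: card_Diff_singleton)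
  moreover have "?\<Phi>' \<subseteq> components (- ?D)" using keep XY by auto
  moreover have "finite ?\<Phi>'" using assms(1) by simp
  ultimately show ?thesis using that by metis
qed

end

subsection \<open>Non-backtracking walks and cycles\<close>

text \<open>Only immediate returns are excluded; vertices may repeat. Such walks can be prolonged
  step by step, and a girth bound later turns short ones into paths.\<close>

fun nbwalk :: "'a set set \<Rightarrow> 'a list \<Rightarrow> bool" where
  "nbwalk E (x # y # z # xs) \<longleftrightarrow> {x, y} \<in> E \<and> x \<noteq> z \<and> nbwalk E (y # z # xs)"
| "nbwalk E [x, y] \<longleftrightarrow> {x, y} \<in> E"
| "nbwalk E [x] \<longleftrightarrow> True"
| "nbwalk E [] \<longleftrightarrow> True"

lemma nbwalk_Cons:
  "nbwalk E (x # xs) \<longleftrightarrow> xs = [] \<or>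
     {x, hd xs} \<in> E \<and> (tl xs = [] \<or> x \<noteq> hd (tl xs)) \<and> nbwalk E xs"
proof (cases xs)
  case (Cons y ys)
  then show ?thesis by (cases ys) simp_all
qed simp

lemma nbwalk_nth:
  assumes "nbwalk E xs"
  shows "Suc i < length xs \<Longrightarrow> {xs ! i, xs ! Suc i} \<in> E"
    and "Suc (Suc i) < length xs \<Longrightarrow> xs ! i \<noteq> xs ! Suc (Suc i)"
  using assms
proof (induction E xs arbitrary: i rule: nbwalk.induct)
  case (1 E x y z xs)
  { case 1 then show ?case using "1.IH"(1) by (cases i) auto }
  { case 2 then show ?case using "1.IH"(2) by (cases i) auto }
qed auto

lemma nbwalkI:
  assumes "\<And>i. Suc i < length xs \<Longrightarrow> {xs ! i, xs ! Suc i} \<in> E"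
    and "\<And>i. Suc (Suc i) < length xs \<Longrightarrow> xs ! i \<noteq> xs ! Suc (Suc i)"
  shows "nbwalk E xs"
  using assms
proof (induction E xs rule: nbwalk.induct)
  case (1 E x y z xs)
  have "nbwalk E (y # z # xs)"
  proof (rule "1.IH")
    fix i
    show "{(y # z # xs) ! i, (y # z # xs) ! Suc i} \<in> E" if "Suc i < length (y # z # xs)"
      using "1.prems"(1)[of "Suc i"] that by simp
    show "(y # z # xs) ! i \<noteq> (y # z # xs) ! Suc (Suc i)" if "Suc (Suc i) < length (y # z # xs)"
      using "1.prems"(2)[of "Suc i"] that by simp
  qed
  then show ?case using "1.prems"(1)[of 0] "1.prems"(2)[of 0] by simp
qed auto

lemma nbwalk_join:
  assumes "nbwalk E (v # p)" "nbwalk E (v # q)" "p = [] \<or> q = [] \<or> hd p \<noteq> hd q"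
  shows "nbwalk E (rev p @ v # q)"
  using assms
proof (induction p arbitrary: v q)
  case (Cons a p)
  have "nbwalk E (a # v # q)"
    using Cons.prems by (auto simp: nbwalk_Cons insert_commute)
  moreover have "nbwalk E (a # p)" "p = [] \<or> hd p \<noteq> v"
    using Cons.prems by (auto simp: nbwalk_Cons)
  ultimately have "nbwalk E (rev p @ a # v # q)" by (intro Cons.IH) auto
  then show ?case by simp
qed simp

text \<open>Take two equal entries at the least positive distance \<open>k\<close>. Minimality makes
  the stretch between them injective; \<open>k = 1\<close> would be a loop and \<open>k = 2\<close>
  a backtrack, so the stretch is a cycle.\<close>

lemma nbwalk_cycle:
  assumes "\<And>e. e \<in> E \<Longrightarrow> card e = 2" "nbwalk E xs" "\<not> distinct xs"
  obtains vs where "is_cycle E vs" "length vs < length xs"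
proof -
  let ?P = "\<lambda>k. 0 < k \<and> (\<exists>i. i + k < length xs \<and> xs ! i = xs ! (i + k))"
  obtain i j where "i < j" "j < length xs" "xs ! i = xs ! j"
    using assms(3) by (metis distinct_conv_nth linorder_neqE_nat)
  then have "?P (j - i)" by (intro conjI exI[of _ i]) auto
  define k where "k = (LEAST k. ?P k)"
  have "?P k" unfolding k_def by (rule LeastI[of ?P]) fact
  then obtain i where i: "0 < k" "i + k < length xs" "xs ! i = xs ! (i + k)" by auto
  have min: "xs ! m \<noteq> xs ! n" if "m < n" "n < m + k" "n < length xs" for m n
  proof
    assume "xs ! m = xs ! n"
    then have "?P (n - m)" using that by (intro conjI exI[of _ m]) auto
    then have "k \<le> n - m" unfolding k_def by (rule Least_le)
    then show False using that by simp
  qed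
  have "k \<noteq> 1"
    using nbwalk_nth(1)[OF assms(2), of i] i assms(1)[of "{xs ! i, xs ! Suc i}"] by auto
  moreover have "k \<noteq> 2" using nbwalk_nth(2)[OF assms(2), of i] i by auto
  ultimately have "3 \<le> k" using i(1) by simp
  define vs where "vs = take k (drop i xs)"
  have len: "length vs = k" using i by (simp add: vs_def)
  have nth: "vs ! n = xs ! (i + n)" if "n < k" for n
    using that i by (simp add: vs_def)
  have "distinct vs"
    unfolding distinct_conv_nth len
  proof (intro allI impI)
    fix m n assume "m < k" "n < k" "m \<noteq> n"
    then show "vs ! m \<noteq> vs ! n"
      using min[of "i + m" "i + n"] min[of "i + n" "i + m"] nth i
      by (cases "m < n") (auto simp: not_less)
  qed
  moreover have "{vs ! n, vs ! (Suc n mod k)} \<in> E" if "n < k" for n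
  proof (cases "Suc n = k")
    case True
    then have "{vs ! n, vs ! (Suc n mod k)} = {xs ! (i + n), xs ! Suc (i + n)}"
      using i nth[of n] nth[of 0] by auto
    then show ?thesis using nbwalk_nth(1)[OF assms(2), of "i + n"] i that by simp
  next
    case False
    then show ?thesis
      using nbwalk_nth(1)[OF assms(2), of "i + n"] i that nth[of n] nth[of "Suc n"] by auto
  qed
  ultimately have "is_cycle E vs" using \<open>3 \<le> k\<close> len by (auto simp: is_cycle_def)
  then show ?thesis using that len i by simp
qed

lemma cycle_mono: "is_cycle E vs \<Longrightarrow> E \<subseteq> E' \<Longrightarrow> is_cycle E' vs"
  by (auto simp: is_cycle_def)

section \<open>Finite simple graphs: degrees, leaves and forests\<close>

lemma simple_graph_finite: "simple_graph V E \<Longrightarrow> finite V" "simple_graph V E \<Longrightarrow> finite E"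
proof -
  assume "simple_graph V E"
  then show "finite V" by (simp add: simple_graph_def)
  moreover have "E \<subseteq> Pow V" using \<open>simple_graph V E\<close> by (auto simp: simple_graph_def)
  ultimately show "finite E" by (meson finite_Pow_iff finite_subset)
qed

lemma simple_graph_edge:
  assumes "simple_graph V E" "{u, v} \<in> E"
  shows "u \<noteq> v" "u \<in> V" "v \<in> V"
proof -
  have "card {u, v} = 2" "{u, v} \<subseteq> V" using assms by (auto simp: simple_graph_def)
  then show "u \<noteq> v" "u \<in> V" "v \<in> V" by auto
qed

lemma simple_graph_edgeE:
  assumes "simple_graph V E" "e \<in> E"
  obtains u v where "e = {u, v}" "u \<noteq> v" "u \<in> V" "v \<in> V"
proof -
  have "e \<subseteq> V" "card e = 2" using assms by (auto simp: simple_graph_def)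
  then show ?thesis using that by (metis card_2_iff insert_subset)
qed

lemma neighborhood_sym: "u \<in> neighborhood E v \<longleftrightarrow> v \<in> neighborhood E u"
  by (simp add: neighborhood_def insert_commute)

lemma neighborhood_subset:
  assumes "simple_graph V E"
  shows "neighborhood E v \<subseteq> V - {v}"
proof
  fix u assume "u \<in> neighborhood E v"
  then have "{v, u} \<in> E" by (simp add: neighborhood_def)
  from simple_graph_edge[OF assms this] show "u \<in> V - {v}" by simp
qed

lemma finite_neighborhood: "simple_graph V E \<Longrightarrow> finite (neighborhood E v)"
  by (rule finite_subset[OF neighborhood_subset]) (auto dest: simple_graph_finite(1))

lemma card_incident:
  assumes "simple_graph V E"
  shows "card {e \<in> E. v \<in> e} = card (neighborhood E v)"
proof (rule bij_betw_same_card[symmetric])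
  show "bij_betw (\<lambda>u. {v, u}) (neighborhood E v) {e \<in> E. v \<in> e}"
  proof (rule bij_betwI')
    fix e assume "e \<in> {e \<in> E. v \<in> e}"
    then have e: "e \<in> E" "v \<in> e" by auto
    obtain x y where "e = {x, y}" using simple_graph_edgeE[OF assms e(1)] by metis
    then have "e = {x, y}" "{x, y} \<in> E" "v = x \<or> v = y" using e by auto
    then show "\<exists>u\<in>neighborhood E v. e = {v, u}"
      by (auto simp: neighborhood_def insert_commute)
  qed (auto simp: neighborhood_def doubleton_eq_iff)
qed

lemma handshake:
  assumes "simple_graph V E"
  shows "(\<Sum>v\<in>V. card (neighborhood E v)) = 2 * card E"
proof -
  note fin = simple_graph_finite[OF assms]
  have "(\<Sum>v\<in>V. card (neighborhood E v)) = (\<Sum>v\<in>V. \<Sum>e\<in>E. if v \<in> e then 1 else 0)"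
    using fin by (simp add: card_incident[OF assms, symmetric] sum.If_cases Int_def)
  also have "\<dots> = (\<Sum>e\<in>E. \<Sum>v\<in>V. if v \<in> e then 1 else 0)" by (rule sum.swap)
  also have "\<dots> = (\<Sum>e\<in>E. 2)"
  proof (rule sum.cong[OF refl])
    fix e assume "e \<in> E"
    then have "e \<subseteq> V" "card e = 2" using assms by (auto simp: simple_graph_def)
    then show "(\<Sum>v\<in>V. if v \<in> e then 1 else 0) = (2::nat)"
      using fin by (simp add: sum.If_cases Int_absorb1)
  qed
  finally show ?thesis by simp
qed

text \<open>Without leaves every walk can be continued without turning back, and with more than
  \<open>card V\<close> entries it must repeat a vertex.\<close>

lemma no_leaf_cycle:
  assumes G: "simple_graph V E" and "E \<noteq> {}" and deg: "\<And>v. card (neighborhood E v) \<noteq> 1"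
  shows "\<exists>vs. is_cycle E vs"
proof -
  have ext: "\<exists>z. {y, z} \<in> E \<and> z \<noteq> x" if "{x, y} \<in> E" for x y
  proof (rule ccontr)
    assume "\<not> ?thesis"
    then have "neighborhood E y \<subseteq> {x}" unfolding neighborhood_def by blast
    moreover have "x \<in> neighborhood E y" using that by (simp add: neighborhood_def insert_commute)
    ultimately have "neighborhood E y = {x}" by blast
    then show False using deg[of y] by simp
  qed
  have "\<exists>xs. nbwalk E xs \<and> length xs = n + 2" for n
  proof (induction n)
    case 0
    obtain e where "e \<in> E" using \<open>E \<noteq> {}\<close> by auto
    then obtain u v where "{u, v} \<in> E" by (metis simple_graph_edgeE[OF G])
    then show ?case by (intro exI[of _ "[u, v]"]) simp
  next
    case (Suc n)
    then obtain y x xs where xs: "nbwalk E (y # x # xs)" "length xs = n"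
      by (metis add_2_eq_Suc' length_Suc_conv)
    then have "{x, y} \<in> E" by (simp add: nbwalk_Cons insert_commute)
    then obtain z where "{y, z} \<in> E" "z \<noteq> x" using ext by blast
    then show ?case using xs by (intro exI[of _ "z # y # x # xs"]) (simp add: insert_commute)
  qed
  then obtain xs where xs: "nbwalk E xs" "length xs = card V + 2" by blast
  have "xs ! i \<in> V" if "i < length xs" for i
  proof (cases "Suc i < length xs")
    case True then show ?thesis using nbwalk_nth(1)[OF xs(1)] simple_graph_edge[OF G] by blast
  next
    case False
    then obtain j where "i = Suc j" using xs that by (cases i) auto
    then show ?thesis using nbwalk_nth(1)[OF xs(1), of j] that simple_graph_edge[OF G] by blast
  qed
  then have "set xs \<subseteq> V" by (auto simp: in_set_conv_nth)
  then have "card (set xs) \<le> card V" using G by (simp add: card_mono simple_graph_def)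
  then have "\<not> distinct xs" using xs(2) distinct_card by fastforce
  moreover have "card e = 2" if "e \<in> E" for e using G that by (simp add: simple_graph_def)
  ultimately show ?thesis using nbwalk_cycle[of E xs] xs(1) by metis
qed

lemma leaf_edge:
  assumes G: "simple_graph V E" and "E \<noteq> {}" and "\<nexists>vs. is_cycle E vs"
  obtains u v where "{u, v} \<in> E" "\<And>e. e \<in> E \<Longrightarrow> v \<in> e \<Longrightarrow> e = {u, v}"
proof -
  obtain v where "card (neighborhood E v) = 1" using no_leaf_cycle[OF G] assms by blast
  then obtain u where u: "neighborhood E v = {u}" by (auto simp: card_1_singleton_iff)
  have "e = {u, v}" if e: "e \<in> E" "v \<in> e" for e
  proof -
    obtain x y where "e = {x, y}" using simple_graph_edgeE[OF G e(1)] by metis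
    with e consider "e = {v, y}" "y \<in> neighborhood E v" | "e = {v, x}" "x \<in> neighborhood E v"
      by (auto simp: neighborhood_def insert_commute)
    then show ?thesis using u by cases (simp_all add: insert_commute)
  qed
  moreover have "{u, v} \<in> E" using u by (auto simp: neighborhood_def insert_commute)
  ultimately show ?thesis using that by blast
qed

text \<open>Deleting a leaf removes one vertex and one edge. The bound \<open>card V\<close>, one
  more than the sharp one, keeps the base case trivial and is all that the face count asks
  for.\<close>

lemma acyclic_card:
  assumes "simple_graph V E" "\<nexists>vs. is_cycle E vs"
  shows "card E \<le> card V"
  using assms
proof (induction "card V" arbitrary: V E rule: less_induct)
  case less
  note fin = simple_graph_finite[OF less.prems(1)]
  show ?case
  proof (cases "E = {}")
    case False
    then obtain u v where uv: "{u, v} \<in> E" "\<And>e. e \<in> E \<Longrightarrow> v \<in> e \<Longrightarrow> e = {u, v}"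
      using leaf_edge[OF less.prems(1) False less.prems(2)] by blast
    have v: "v \<in> V" using simple_graph_edge[OF less.prems(1) uv(1)] by simp
    have "simple_graph (V - {v}) (E - {{u, v}})"
      unfolding simple_graph_def
    proof (intro conjI ballI)
      fix e assume e: "e \<in> E - {{u, v}}"
      then have "v \<notin> e" using uv(2)[of e] by auto
      moreover have "e \<subseteq> V" "card e = 2" using e less.prems(1) by (auto simp: simple_graph_def)
      ultimately show "e \<subseteq> V - {v}" "card e = 2" by auto
    qed (simp add: fin)
    moreover have "\<nexists>vs. is_cycle (E - {{u, v}}) vs"
      using less.prems(2) cycle_mono by blast
    moreover have "card (V - {v}) < card V" using fin v by (meson card_Diff1_less)
    ultimately have "card (E - {{u, v}}) \<le> card (V - {v})" using less.hyps by blast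
    then show ?thesis
      using card_Suc_Diff1[OF fin(1) v] card_Suc_Diff1[OF fin(2) uv(1)] by simp
  qed simp
qed

section \<open>The edges of a cycle\<close>

definition cycle_edges :: "'a list \<Rightarrow> 'a set set" where
  "cycle_edges vs = (\<lambda>i. {vs ! i, vs ! (Suc i mod length vs)}) ` {..<length vs}"

lemma cycle_edges_subset: "is_cycle E vs \<Longrightarrow> cycle_edges vs \<subseteq> E"
  by (auto simp: is_cycle_def cycle_edges_def)

lemma card_cycle_edges:
  assumes "is_cycle E vs"
  shows "card (cycle_edges vs) = length vs"
proof -
  let ?n = "length vs"
  have n: "3 \<le> ?n" and d: "distinct vs" using assms by (auto simp: is_cycle_def)
  have "inj_on (\<lambda>i. {vs ! i, vs ! (Suc i mod ?n)}) {..<?n}"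
  proof (rule inj_onI)
    fix i j assume ij: "i \<in> {..<?n}" "j \<in> {..<?n}"
      "{vs ! i, vs ! (Suc i mod ?n)} = {vs ! j, vs ! (Suc j mod ?n)}"
    have "0 < ?n" using n by linarith
    then have lt: "Suc i mod ?n < ?n" "Suc j mod ?n < ?n" by simp_all
    from ij(3) have "vs ! i = vs ! j \<or> vs ! i = vs ! (Suc j mod ?n) \<and> vs ! (Suc i mod ?n) = vs ! j"
      by (auto simp: doubleton_eq_iff)
    then have "i = j \<or> i = Suc j mod ?n \<and> Suc i mod ?n = j"
      using nth_eq_iff_index_eq[OF d] ij(1,2) lt by auto
    \<comment> \<open>Two distinct indices that are cyclic successors of each other exist only
      modulo 2.\<close>
    then show "i = j"
      using ij(1,2) n by (cases "Suc i = ?n"; cases "Suc j = ?n") auto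
  qed
  then show ?thesis unfolding cycle_edges_def by (simp add: card_image)
qed

lemma cycle_through_edge:
  assumes "is_cycle E vs" "e \<in> cycle_edges vs"
  obtains xs where "3 \<le> length xs" "distinct xs" "e = {last xs, hd xs}"
    "\<And>i. Suc i < length xs \<Longrightarrow> {xs ! i, xs ! Suc i} \<in> cycle_edges vs - {e}"
proof -
  let ?n = "length vs"
  have n: "3 \<le> ?n" and d: "distinct vs" using assms by (auto simp: is_cycle_def)
  obtain k where k: "k < ?n" "e = {vs ! k, vs ! (Suc k mod ?n)}"
    using assms(2) by (auto simp: cycle_edges_def)
  \<comment> \<open>This rotation puts the ends of \<open>e\<close> in the last and first positions,
    so the consecutive pairs are the other edges of the cycle.\<close>
  define xs where "xs = rotate (Suc k) vs"
  have len: "length xs = ?n" and dx: "distinct xs" using d by (simp_all add: xs_def)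
  have nth: "xs ! i = vs ! ((Suc k + i) mod ?n)" if "i < ?n" for i
    using that n unfolding xs_def by (subst nth_rotate) auto
  have "xs \<noteq> []" "vs \<noteq> []" and length_pos: "0 < ?n" using len n by auto
  have "hd xs = vs ! (Suc k mod ?n)" using nth[of 0] \<open>xs \<noteq> []\<close> \<open>vs \<noteq> []\<close> len by (simp add: hd_conv_nth)
  moreover have "last xs = vs ! k"
  proof -
    have "Suc k + (?n - 1) = k + ?n" using n by simp
    then show ?thesis using nth[of "?n - 1"] n k(1) \<open>xs \<noteq> []\<close> len by (simp add: last_conv_nth)
  qed
  ultimately have e: "e = {last xs, hd xs}" using k by simp
  have "{xs ! i, xs ! Suc i} \<in> cycle_edges vs - {e}" if i: "Suc i < length xs" for i
  proof -
    have "{xs ! i, xs ! Suc i} \<in> cycle_edges vs"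
      using nth[of i] nth[of "Suc i"] i len n
      by (auto simp: cycle_edges_def mod_Suc_eq intro!: image_eqI[of _ _ "(Suc k + i) mod ?n"]
            mod_less_divisor[OF length_pos])
    moreover have "{xs ! i, xs ! Suc i} \<noteq> e"
    proof
      assume "{xs ! i, xs ! Suc i} = e"
      then have "{xs ! i, xs ! Suc i} = {xs ! (?n - 1), xs ! 0}"
        using e \<open>xs \<noteq> []\<close> len by (simp add: hd_conv_nth last_conv_nth)
      then consider "xs ! i = xs ! (?n - 1)" | "xs ! i = xs ! 0" "xs ! Suc i = xs ! (?n - 1)"
        unfolding doubleton_eq_iff by blast
      then show False
      proof cases
        case 1
        then have "i = ?n - 1" using i len by (subst (asm) nth_eq_iff_index_eq[OF dx]) simp_all
        then show False using i len by simp
      next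
        case 2
        then have "i = 0" using i by (subst (asm) nth_eq_iff_index_eq[OF dx]) auto
        moreover have "Suc i = ?n - 1"
          using 2(2) i len by (subst (asm) nth_eq_iff_index_eq[OF dx]) simp_all
        ultimately show False using n by simp
      qed
    qed
    ultimately show ?thesis by simp
  qed
  moreover have "3 \<le> length xs" using n len by simp
  ultimately show ?thesis using that[OF _ dx e] by metis
qed

subsection \<open>Faces of plane graphs\<close>

locale plane_graph =
  fixes V :: "'a set" and E :: "'a set set" and p :: "'a \<Rightarrow> complex"
    and \<gamma> :: "'a set \<Rightarrow> real \<Rightarrow> complex"
  assumes graph: "simple_graph V E" and drawing: "plane_drawing V E p \<gamma>"
begin

lemmas fin = simple_graph_finite[OF graph]

text \<open>All vertices are drawn for every \<open>H\<close>, so deleting an edge deletes only its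
  open arc, and a further edge meets the drawing exactly in its two ends.\<close>

definition drawn :: "'a set set \<Rightarrow> complex set" where
  "drawn H = p ` V \<union> (\<Union>e\<in>H. path_image (\<gamma> e))"

lemma edge_subset: "e \<in> E \<Longrightarrow> e \<subseteq> V"
  using graph by (auto simp: simple_graph_def)

lemma arc_edge: "e \<in> E \<Longrightarrow> arc (\<gamma> e)"
  using drawing by (simp add: plane_drawing_def)

lemma edge_ends: "e \<in> E \<Longrightarrow> {pathstart (\<gamma> e), pathfinish (\<gamma> e)} = p ` e"
  using drawing by (simp add: plane_drawing_def)

lemma edge_vertices: "e \<in> E \<Longrightarrow> path_image (\<gamma> e) \<inter> p ` V = p ` e"
  using drawing by (simp add: plane_drawing_def)

lemma edges_meet: "e \<in> E \<Longrightarrow> e' \<in> E \<Longrightarrow> e \<noteq> e' \<Longrightarrow> path_image (\<gamma> e) \<inter> path_image (\<gamma> e') = p ` (e \<inter> e')"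
  using drawing by (simp add: plane_drawing_def)

lemma compact_arcs: "H \<subseteq> E \<Longrightarrow> compact (\<Union>e\<in>H. path_image (\<gamma> e))"
  using fin(2) arc_edge by (intro compact_UN) (auto intro: finite_subset compact_arc_image)

lemma compact_drawn: "H \<subseteq> E \<Longrightarrow> compact (drawn H)"
  unfolding drawn_def using fin(1) by (intro compact_Un[OF finite_imp_compact compact_arcs]) auto

lemma drawn_insert: "e \<in> H \<Longrightarrow> drawn H = drawn (H - {e}) \<union> path_image (\<gamma> e)"
  by (auto simp: drawn_def)

lemma edge_drawn:
  assumes "H \<subseteq> E" "e \<in> E" "e \<notin> H"
  shows "path_image (\<gamma> e) \<inter> drawn H = p ` e"
proof
  show "path_image (\<gamma> e) \<inter> drawn H \<subseteq> p ` e"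
  proof
    fix z assume z: "z \<in> path_image (\<gamma> e) \<inter> drawn H"
    then consider "z \<in> p ` V" | e' where "e' \<in> H" "z \<in> path_image (\<gamma> e')"
      by (auto simp: drawn_def)
    then show "z \<in> p ` e"
    proof cases
      case 1
      then show ?thesis using z edge_vertices[OF assms(2)] by auto
    next
      case 2
      then have "e' \<in> E" "e \<noteq> e'" using assms by auto
      then show ?thesis using edges_meet[OF assms(2), of e'] 2 z by auto
    qed
  qed
  show "p ` e \<subseteq> path_image (\<gamma> e) \<inter> drawn H"
    using edge_vertices[OF assms(2)] edge_subset[OF assms(2)] by (auto simp: drawn_def)
qed

lemma edge_interior_nonempty: "e \<in> E \<Longrightarrow> path_image (\<gamma> e) - p ` e \<noteq> {}"
  using arc_interior_nonempty[OF arc_edge] edge_ends by simp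

lemma oriented_edge:
  assumes "{u, v} \<in> E"
  obtains g where "arc g" "pathstart g = p u" "pathfinish g = p v"
    "path_image g = path_image (\<gamma> {u, v})"
proof -
  have "{pathstart (\<gamma> {u, v}), pathfinish (\<gamma> {u, v})} = {p u, p v}"
    using edge_ends[OF assms] by simp
  then consider "pathstart (\<gamma> {u, v}) = p u" "pathfinish (\<gamma> {u, v}) = p v"
    | "pathstart (\<gamma> {u, v}) = p v" "pathfinish (\<gamma> {u, v}) = p u"
    by (auto simp: doubleton_eq_iff)
  then show ?thesis
  proof cases
    case 1
    then show ?thesis using that[of "\<gamma> {u, v}"] arc_edge[OF assms] by simp
  next
    case 2
    then show ?thesis
      using that[of "reversepath (\<gamma> {u, v})"] arc_edge[OF assms] by (simp add: arc_reversepath)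
  qed
qed

text \<open>The restriction to edges inside \<open>set xs\<close> carries the induction: no later
  edge contains the new vertex \<open>x\<close>, so the new arc meets the old one only in
  \<open>p y\<close>.\<close>

lemma path_arc:
  assumes "H \<subseteq> E" "2 \<le> length xs" "distinct xs"
    and "\<And>i. Suc i < length xs \<Longrightarrow> {xs ! i, xs ! Suc i} \<in> H"
  shows "\<exists>h. arc h \<and> pathstart h = p (hd xs) \<and> pathfinish h = p (last xs) \<and>
    path_image h \<subseteq> (\<Union>e\<in>{e \<in> H. e \<subseteq> set xs}. path_image (\<gamma> e))"
  using assms(2-)
proof (induction xs)
  case (Cons x xs)
  then obtain y ys where xs: "xs = y # ys" by (cases xs) auto
  have xy: "{x, y} \<in> H" using Cons.prems(3)[of 0] xs by simp
  then obtain g where g: "arc g" "pathstart g = p x" "pathfinish g = p y"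
    "path_image g = path_image (\<gamma> {x, y})"
    using oriented_edge assms(1) by blast
  show ?case
  proof (cases "ys = []")
    case True
    have "{x, y} \<in> {e \<in> H. e \<subseteq> set (x # xs)}" using xy xs by simp
    then show ?thesis using g xs True by (intro exI[of _ g]) auto
  next
    case False
    have "{xs ! i, xs ! Suc i} \<in> H" if "Suc i < length xs" for i
      using Cons.prems(3)[of "Suc i"] that by simp
    moreover have "2 \<le> length xs" using False xs by (cases ys) auto
    ultimately obtain h where h: "arc h" "pathstart h = p (hd xs)" "pathfinish h = p (last xs)"
      "path_image h \<subseteq> (\<Union>e\<in>{e \<in> H. e \<subseteq> set xs}. path_image (\<gamma> e))"
      using Cons.IH Cons.prems(2) by auto
    have "path_image g \<inter> path_image h \<subseteq> {p y}"
    proof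
      fix z assume z: "z \<in> path_image g \<inter> path_image h"
      then obtain e where e: "e \<in> H" "e \<subseteq> set xs" "z \<in> path_image (\<gamma> e)" using h(4) by auto
      have x: "x \<notin> e" using e(2) Cons.prems(2) by auto
      then have "{x, y} \<noteq> e" by auto
      then have "z \<in> p ` ({x, y} \<inter> e)"
        using edges_meet[of "{x, y}" e] xy e z g(4) assms(1) by auto
      then show "z \<in> {p y}" using x by auto
    qed
    then have "arc (g +++ h)" using g h xs by (intro arc_join) simp_all
    moreover have "path_image (g +++ h) = path_image g \<union> path_image h"
      using g h xs by (simp add: path_image_join)
    then have "path_image (g +++ h) \<subseteq> (\<Union>e\<in>{e \<in> H. e \<subseteq> set (x # xs)}. path_image (\<gamma> e))"
      using h(4) g(4) xy xs by fastforce
    ultimately show ?thesis using g h xs False by (intro exI[of _ "g +++ h"]) simp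
  qed
qed simp

lemma closing_edge:
  assumes "H \<subseteq> E" "is_cycle H vs" "e \<in> cycle_edges vs"
  obtains g h where "closing_arc g h (drawn (H - {e}))" "path_image g = path_image (\<gamma> e)"
    "{pathstart g, pathfinish g} = p ` e"
proof -
  obtain xs where xs: "3 \<le> length xs" "distinct xs" "e = {last xs, hd xs}"
    and edge: "\<And>i. Suc i < length xs \<Longrightarrow> {xs ! i, xs ! Suc i} \<in> cycle_edges vs - {e}"
    using cycle_through_edge[OF assms(2,3)] by blast
  have eH: "e \<in> H" "e \<in> E" using cycle_edges_subset[OF assms(2)] assms by auto
  obtain g where g: "arc g" "pathstart g = p (last xs)" "pathfinish g = p (hd xs)"
    "path_image g = path_image (\<gamma> e)"
    using oriented_edge[of "last xs" "hd xs"] eH xs(3) by auto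
  have "H - {e} \<subseteq> E" using assms by auto
  moreover have "{xs ! i, xs ! Suc i} \<in> H - {e}" if "Suc i < length xs" for i
    using edge[OF that] cycle_edges_subset[OF assms(2)] by auto
  ultimately obtain h where h: "arc h" "pathstart h = p (hd xs)" "pathfinish h = p (last xs)"
    "path_image h \<subseteq> (\<Union>e'\<in>{e' \<in> H - {e}. e' \<subseteq> set xs}. path_image (\<gamma> e'))"
    using path_arc[of "H - {e}" xs] xs(1,2) by auto
  have ends: "{pathstart g, pathfinish g} = p ` e" using g xs(3) by auto
  have "closing_arc g h (drawn (H - {e}))"
  proof
    show "compact (drawn (H - {e}))" using assms by (intro compact_drawn) auto
    show "path_image g \<inter> drawn (H - {e}) = {pathstart g, pathfinish g}"
      using edge_drawn[of "H - {e}" e] eH assms ends g(4) by auto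
    show "path_image h \<subseteq> drawn (H - {e})" using h(4) by (auto simp: drawn_def)
  qed (use g h in auto)
  then show ?thesis using that g(4) ends by blast
qed

text \<open>One inequality of Euler's formula: deleting an edge of a cycle costs at least one face,
  and once no cycle is left a single face is enough, which exists because a compact drawing cannot
  fill the plane.\<close>

lemma many_faces:
  assumes "H \<subseteq> E"
  shows "\<exists>\<Phi>. finite \<Phi> \<and> \<Phi> \<subseteq> components (- drawn H) \<and> card H + 1 \<le> card \<Phi> + card V"
  using assms
proof (induction "card H" arbitrary: H rule: less_induct)
  case less
  have finH: "finite H" using less.prems fin(2) finite_subset by blast
  show ?case
  proof (cases "\<exists>vs. is_cycle H vs")
    case False
    have "simple_graph V H" using graph less.prems by (auto simp: simple_graph_def)
    then have "card H \<le> card V" using acyclic_card False by blast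
    moreover have "drawn H \<noteq> UNIV"
      using compact_drawn[OF less.prems] compact_imp_bounded not_bounded_UNIV by metis
    then obtain z where "z \<in> - drawn H" by auto
    then have "connected_component_set (- drawn H) z \<in> components (- drawn H)"
      by (auto simp: components_iff)
    ultimately show ?thesis
      by (intro exI[of _ "{connected_component_set (- drawn H) z}"]) auto
  next
    case True
    then obtain vs where vs: "is_cycle H vs" by blast
    then have "card (cycle_edges vs) \<noteq> 0" using card_cycle_edges[OF vs] by (auto simp: is_cycle_def)
    then obtain e where e: "e \<in> cycle_edges vs" by fastforce
    then have eH: "e \<in> H" using cycle_edges_subset[OF vs] by auto
    obtain g h where gh: "closing_arc g h (drawn (H - {e}))" "path_image g = path_image (\<gamma> e)"
      "{pathstart g, pathfinish g} = p ` e"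
      by (rule closing_edge[OF less.prems vs e])
    have card: "card H = Suc (card (H - {e}))" using card_Suc_Diff1[OF finH eH] by simp
    then obtain \<Phi> where \<Phi>: "finite \<Phi>" "\<Phi> \<subseteq> components (- drawn (H - {e}))"
      "card (H - {e}) + 1 \<le> card \<Phi> + card V"
      using less.hyps[of "H - {e}"] less.prems by auto
    obtain \<Phi>' where "finite \<Phi>'" "\<Phi>' \<subseteq> components (- drawn H)" "card \<Phi>' \<ge> Suc (card \<Phi>)"
      using closing_arc.more_components[OF gh(1) \<Phi>(1,2)] drawn_insert[OF eH] gh(2) by metis
    then show ?thesis using card \<Phi>(3) by (intro exI[of _ \<Phi>']) auto
  qed
qed

text \<open>A leaf edge meets the remaining edges in at most its inner end, a connected set, so
  Janiszewski's theorem combines the complement of one arc with that of the smaller forest. The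
  vertex points are deleted afterwards, in \<open>boundary_cycle\<close>.\<close>

lemma connected_forest_complement:
  assumes "H \<subseteq> E" "\<nexists>vs. is_cycle H vs"
  shows "connected (- (\<Union>e\<in>H. path_image (\<gamma> e)))"
  using assms
proof (induction "card H" arbitrary: H rule: less_induct)
  case less
  have finH: "finite H" using less.prems fin(2) finite_subset by blast
  have H: "simple_graph V H" using graph less.prems by (auto simp: simple_graph_def)
  show ?case
  proof (cases "H = {}")
    case False
    obtain u v where uv: "{u, v} \<in> H" "\<And>e. e \<in> H \<Longrightarrow> v \<in> e \<Longrightarrow> e = {u, v}"
      using leaf_edge[OF H False less.prems(2)] by metis
    let ?H = "H - {{u, v}}"
    let ?S = "path_image (\<gamma> {u, v})" and ?T = "\<Union>e\<in>?H. path_image (\<gamma> e)"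
    have E: "{u, v} \<in> E" "?H \<subseteq> E" using uv(1) less.prems(1) by auto
    have "card ?H < card H" using uv(1) finH by (intro psubset_card_mono) auto
    moreover have "\<nexists>vs. is_cycle ?H vs" using less.prems(2) cycle_mono[of ?H _ H] by blast
    ultimately have T: "connected (- ?T)" using less.hyps E by blast
    have S: "connected (- ?S)" using connected_arc_complement[OF arc_edge[OF E(1)]] by simp
    have "?S \<inter> ?T \<subseteq> {p u}"
    proof
      fix z assume "z \<in> ?S \<inter> ?T"
      then obtain e where e: "e \<in> ?H" "z \<in> path_image (\<gamma> e)" "z \<in> ?S" by auto
      then have "z \<in> p ` ({u, v} \<inter> e)" using edges_meet[of "{u, v}" e] E by auto
      moreover have "v \<notin> e" using uv(2) e(1) by auto
      ultimately show "z \<in> {p u}" by auto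
    qed
    then have ST: "connected (?S \<inter> ?T)"
      by (metis connected_empty connected_sing subset_singletonD)
    have un: "(\<Union>e\<in>H. path_image (\<gamma> e)) = ?S \<union> ?T" using uv(1) by auto
    show ?thesis
      unfolding un connected_iff_connected_component
    proof (intro ballI)
      fix a b assume ab: "a \<in> - (?S \<union> ?T)" "b \<in> - (?S \<union> ?T)"
      show "connected_component (- (?S \<union> ?T)) a b"
      proof (rule Janiszewski[OF _ _ ST])
        show "compact ?S" by (rule compact_arc_image[OF arc_edge[OF E(1)]])
        show "closed ?T" by (rule compact_imp_closed[OF compact_arcs[OF E(2)]])
        show "connected_component (- ?S) a b" "connected_component (- ?T) a b"
          using S T ab unfolding connected_iff_connected_component by auto
      qed
    qed
  qed (simp add: connected_UNIV)
qed

text \<open>Only open arcs count: an edge touching the face merely in one of its ends is no boundary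
  edge.\<close>

definition boundary :: "complex set \<Rightarrow> 'a set set" where
  "boundary C = {e \<in> E. frontier C \<inter> (path_image (\<gamma> e) - p ` e) \<noteq> {}}"

text \<open>If the boundary edges formed a forest, their complement would be connected and hence
  equal to the face, leaving no room for any further edge.\<close>

lemma boundary_cycle:
  assumes C: "C \<in> components (- drawn E)" and "is_cycle E ws"
  obtains vs where "is_cycle (boundary C) vs"
proof (rule ccontr)
  assume "\<not> thesis"
  then have acyc: "\<nexists>vs. is_cycle (boundary C) vs" using that by blast
  have BE: "boundary C \<subseteq> E" by (auto simp: boundary_def)
  have "open (- (\<Union>e\<in>boundary C. path_image (\<gamma> e)))"
    using compact_arcs[OF BE] compact_imp_closed open_Compl by blast
  then have "connected (- (\<Union>e\<in>boundary C. path_image (\<gamma> e)) - p ` V)"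
    using connected_forest_complement[OF BE acyc] fin(1) by (intro connected_open_delete_finite) auto
  moreover have "- (\<Union>e\<in>boundary C. path_image (\<gamma> e)) - p ` V = - drawn (boundary C)"
    by (auto simp: drawn_def)
  ultimately have con: "connected (- drawn (boundary C))" by simp
  have closed: "closed (drawn E)" using compact_drawn compact_imp_closed by blast
  have fr: "frontier C \<subseteq> drawn E" by (rule frontier_of_components_closed_complement[OF closed C])
  have "- drawn (boundary C) \<inter> frontier C = {}"
  proof (rule ccontr)
    assume "\<not> ?thesis"
    then obtain z where z: "z \<notin> drawn (boundary C)" "z \<in> frontier C" by auto
    then obtain e where e: "e \<in> E" "z \<in> path_image (\<gamma> e)" "z \<notin> p ` V"
      using fr by (auto simp: drawn_def)
    have "z \<notin> p ` e" using e(3) edge_subset[OF e(1)] by auto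
    then have "e \<in> boundary C" using z(2) e unfolding boundary_def by auto
    then show False using z e by (auto simp: drawn_def)
  qed
  moreover have sub: "C \<subseteq> - drawn E" "C \<noteq> {}"
    using in_components_subset[OF C] in_components_nonempty[OF C] by auto
  moreover have "- drawn E \<subseteq> - drawn (boundary C)" using BE by (auto simp: drawn_def)
  ultimately have "- drawn (boundary C) \<subseteq> C"
    using connected_Int_frontier[OF con, of C] by blast
  then have DE: "drawn E \<subseteq> drawn (boundary C)" using sub by auto
  have "e \<in> boundary C" if "e \<in> E" for e
  proof (rule ccontr)
    assume "e \<notin> boundary C"
    then have "path_image (\<gamma> e) \<inter> drawn (boundary C) = p ` e" using edge_drawn[OF BE that] by simp
    moreover have "path_image (\<gamma> e) \<subseteq> drawn E" using that by (auto simp: drawn_def)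
    ultimately show False using edge_interior_nonempty[OF that] DE by blast
  qed
  then have "E \<subseteq> boundary C" by blast
  then show False using cycle_mono[OF assms(2)] acyc by blast
qed

text \<open>Double count the pairs of a face and an edge of its boundary that lies on a cycle. The
  restriction to such edges makes \<open>closing_edge\<close> applicable, and the cycle in each
  boundary still supplies \<open>g\<close> of them per face.\<close>

lemma edge_bound:
  assumes "V \<noteq> {}" and long: "\<And>vs. is_cycle E vs \<Longrightarrow> g \<le> length vs" and "3 \<le> g"
  shows "(g - 2) * card E < g * card V"
proof (cases "\<exists>ws. is_cycle E ws")
  case False
  then have "card E \<le> card V" using acyclic_card[OF graph] by blast
  then have "(g - 2) * card E \<le> (g - 2) * card V" by simp
  moreover have "0 < card V" using assms(1) fin(1) by (simp add: card_gt_0_iff)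
  then have "(g - 2) * card V < g * card V" using \<open>3 \<le> g\<close> by (intro mult_less_mono1) auto
  ultimately show ?thesis by (rule le_less_trans)
next
  case True
  then obtain ws where ws: "is_cycle E ws" by blast
  define R where "R = {e \<in> E. \<exists>vs. is_cycle E vs \<and> e \<in> cycle_edges vs}"
  have finR: "finite R" and RE: "R \<subseteq> E" using fin(2) by (auto simp: R_def)
  obtain \<Phi> where \<Phi>: "finite \<Phi>" "\<Phi> \<subseteq> components (- drawn E)" "card E + 1 \<le> card \<Phi> + card V"
    using many_faces[of E] by auto
  have lower: "g \<le> card {e \<in> R. e \<in> boundary C}" if C: "C \<in> \<Phi>" for C
  proof -
    obtain vs where vs: "is_cycle (boundary C) vs" using boundary_cycle[OF _ ws, of C] \<Phi>(2) C by blast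
    have BE: "boundary C \<subseteq> E" by (auto simp: boundary_def)
    have "is_cycle E vs" using cycle_mono[OF vs BE] .
    then have "cycle_edges vs \<subseteq> {e \<in> R. e \<in> boundary C}"
      using cycle_edges_subset[OF vs] BE by (auto simp: R_def)
    then have "card (cycle_edges vs) \<le> card {e \<in> R. e \<in> boundary C}"
      using finR by (intro card_mono) auto
    then show ?thesis using card_cycle_edges[OF vs] long[OF \<open>is_cycle E vs\<close>] by simp
  qed
  have upper: "card {C \<in> \<Phi>. e \<in> boundary C} \<le> 2" if eR: "e \<in> R" for e
  proof -
    obtain vs where vs: "is_cycle E vs" "e \<in> cycle_edges vs" using eR by (auto simp: R_def)
    obtain f h where fh: "closing_arc f h (drawn (E - {e}))" "path_image f = path_image (\<gamma> e)"
      "{pathstart f, pathfinish f} = p ` e"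
      by (rule closing_edge[OF subset_refl vs])
    have D: "drawn (E - {e}) \<union> path_image f = drawn E"
      using drawn_insert[of e E] fh(2) eR RE by auto
    show ?thesis
    proof (rule closing_arc.at_most_two_sides[OF fh(1)])
      fix C assume C: "C \<in> {C \<in> \<Phi>. e \<in> boundary C}"
      show "C \<in> components (- (drawn (E - {e}) \<union> path_image f))"
        unfolding D using C \<Phi>(2) by auto
      show "closure C \<inter> (path_image f - {pathstart f, pathfinish f}) \<noteq> {}"
        unfolding fh(2,3) using C by (auto simp: boundary_def frontier_def)
    qed
  qed
  have "g * card \<Phi> \<le> (\<Sum>C\<in>\<Phi>. card {e \<in> R. e \<in> boundary C})"
    using sum_mono[OF lower] by (simp add: mult.commute)
  also have "\<dots> = (\<Sum>e\<in>R. card {C \<in> \<Phi>. e \<in> boundary C})"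
    using sum.swap_restrict[OF \<Phi>(1) finR, of "\<lambda>_ _. 1::nat" "\<lambda>C e. e \<in> boundary C"] by simp
  also have "\<dots> \<le> 2 * card R" using sum_mono[OF upper] by (simp add: mult.commute)
  also have "\<dots> \<le> 2 * card E" using card_mono[OF fin(2) RE] by simp
  finally have 1: "g * card \<Phi> \<le> 2 * card E" .
  have "g * (card E + 1) \<le> g * (card \<Phi> + card V)" using \<Phi>(3) by (rule mult_le_mono2)
  then have "g * card E + g \<le> 2 * card E + g * card V" using 1 by (simp add: algebra_simps)
  \<comment> \<open>This rules out truncation in the natural subtraction \<open>g - 2\<close> after
    distributing.\<close>
  moreover have "2 * card E \<le> g * card E" using \<open>3 \<le> g\<close> by (intro mult_le_mono1) simp
  ultimately show ?thesis using \<open>3 \<le> g\<close> unfolding diff_mult_distrib by linarith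
qed

end

subsection \<open>Extending odd colorings along threads\<close>

text \<open>A sum of even class sizes is even. Hence every coloring serves a vertex of odd
  degree.\<close>

lemma odd_class:
  assumes "finite A" "odd (card A)"
  shows "\<exists>k. odd (card {x \<in> A. f x = k})"
proof (rule ccontr)
  assume "\<not> ?thesis"
  then have "even (\<Sum>k\<in>f ` A. card {x \<in> A. f x = k})" by (intro dvd_sum) auto
  moreover have "card A = (\<Sum>k\<in>f ` A. card {x \<in> A. f x = k})"
    using sum.image_gen[OF assms(1), of "\<lambda>_. 1::nat" f] by simp
  ultimately show False using assms(2) by simp
qed

text \<open>A kept vertex \<open>u\<close> is safe if it lost no neighbor, if its degree is odd, or
  if its only removed neighbor avoids \<open>d u\<close>: in the last case the class of color
  \<open>d u\<close> around \<open>u\<close> is unchanged.\<close>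

lemma odd_coloring_extend:
  fixes V :: "'a set" and E :: "'a set set"
  assumes G: "simple_graph V E" and f: "odd_coloring (V - S) E' c f"
    and E': "E' = {e \<in> E. e \<inter> S = {}}"
    and d: "\<And>u. u \<in> V - S \<Longrightarrow> neighborhood E' u \<noteq> {} \<Longrightarrow>
      odd (card {x \<in> neighborhood E' u. f x = d u})"
    and g: "\<And>u. u \<notin> S \<Longrightarrow> g u = f u" "\<And>s. s \<in> S \<Longrightarrow> g s < c"
    and proper: "\<And>s x. s \<in> S \<Longrightarrow> {s, x} \<in> E \<Longrightarrow> g s \<noteq> g x"
    and odd: "\<And>s. s \<in> S \<Longrightarrow> neighborhood E s \<noteq> {} \<Longrightarrow>
      \<exists>k. odd (card {x \<in> neighborhood E s. g x = k})"
    and outer: "\<And>u. u \<in> V - S \<Longrightarrow> neighborhood E u \<inter> S = {} \<or> odd (card (neighborhood E u)) \<or>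
      (\<exists>s. neighborhood E u \<inter> S = {s} \<and> g s \<noteq> d u)"
  shows "odd_coloring V E c g"
proof -
  note finN = finite_neighborhood[OF G]
  have nbh: "neighborhood E' u = neighborhood E u - S" if "u \<notin> S" for u
    using that by (auto simp: E' neighborhood_def)
  have "\<exists>k. odd (card {x \<in> neighborhood E u. g x = k})"
    if u: "u \<in> V" "neighborhood E u \<noteq> {}" for u
  proof (cases "u \<in> S \<or> odd (card (neighborhood E u))")
    case True
    then show ?thesis using odd u odd_class[OF finN] by blast
  next
    case False
    then have uS: "u \<in> V - S" using u by auto
    have ev: "even (card (neighborhood E u))" using False by simp
    \<comment> \<open>If all neighbors of \<open>u\<close> were removed, there would be exactly one,
      against the even degree.\<close>
    have ne: "neighborhood E' u \<noteq> {}"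
    proof
      assume "neighborhood E' u = {}"
      then have "neighborhood E u \<subseteq> S" using nbh uS by auto
      then have "neighborhood E u \<inter> S = neighborhood E u" by auto
      then obtain s where "neighborhood E u = {s}" using outer[OF uS] u ev by auto
      then show False using ev by simp
    qed
    have "g x \<noteq> d u" if "x \<in> neighborhood E u" "x \<in> S" for x
    proof -
      have "x \<in> neighborhood E u \<inter> S" using that by simp
      with outer[OF uS] ev show ?thesis by (metis empty_iff singletonD)
    qed
    then have "x \<in> neighborhood E u \<and> g x = d u \<longleftrightarrow> x \<in> neighborhood E' u \<and> f x = d u" for x
      using uS by (cases "x \<in> S") (auto simp: nbh g(1))
    then have "{x \<in> neighborhood E u. g x = d u} = {x \<in> neighborhood E' u. f x = d u}"
      by simp
    then show ?thesis using d[OF uS ne] by metis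
  qed
  moreover have "g u \<noteq> g v" if uv: "{u, v} \<in> E" for u v
  proof (cases "u \<in> S \<or> v \<in> S")
    case True
    then show ?thesis using proper[of u v] proper[of v u] uv by (auto simp: insert_commute)
  next
    case False
    then have "{u, v} \<in> E'" using uv by (auto simp: E')
    then show ?thesis using f False g(1) by (auto simp: odd_coloring_def proper_coloring_def)
  qed
  moreover have "g u < c" if "u \<in> V" for u
    using that f g(1)[of u] g(2)[of u]
    by (cases "u \<in> S") (auto simp: odd_coloring_def proper_coloring_def)
  ultimately show ?thesis
    using finN by (auto simp: odd_coloring_def proper_coloring_def card_gt_0_iff)
qed

text \<open>The colors along \<open>v\<close>, a thread of 2-vertices and its end vertex; any three consecutive ones
  are distinct. The last thread vertex has to avoid the set \<open>B\<close>, which protects the odd color class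
  at the end vertex.\<close>

definition color_seq :: "nat \<Rightarrow> nat \<Rightarrow> nat \<Rightarrow> nat set \<Rightarrow> nat list \<Rightarrow> bool" where
  "color_seq n c w B L \<longleftrightarrow> length L = Suc n \<and> hd L = c \<and> last L = w \<and> set L \<subseteq> {..<4} \<and>
     nbwalk {e. card e = 2} L \<and> last (butlast L) \<notin> B"

lemma color_seq_simps:
  "color_seq (Suc 0) c w B [c, w] \<longleftrightarrow> c < 4 \<and> w < 4 \<and> c \<noteq> w \<and> c \<notin> B"
  "color_seq 2 c w B [c, x, w] \<longleftrightarrow> c < 4 \<and> x < 4 \<and> w < 4 \<and> c \<noteq> w \<and> c \<noteq> x \<and> x \<noteq> w \<and> x \<notin> B"
  "color_seq 3 c w B [c, x, y, w] \<longleftrightarrow> c < 4 \<and> x < 4 \<and> y < 4 \<and> w < 4 \<and>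
     c \<noteq> x \<and> c \<noteq> y \<and> x \<noteq> y \<and> x \<noteq> w \<and> y \<noteq> w \<and> y \<notin> B"
  "color_seq 4 c w B [c, x, y, z, w] \<longleftrightarrow> c < 4 \<and> x < 4 \<and> y < 4 \<and> z < 4 \<and> w < 4 \<and>
     c \<noteq> x \<and> c \<noteq> y \<and> x \<noteq> y \<and> x \<noteq> z \<and> y \<noteq> z \<and> y \<noteq> w \<and> z \<noteq> w \<and> z \<notin> B"
proof -
  have "card {a, b} = 2 \<longleftrightarrow> a \<noteq> b" for a b :: nat by (simp add: card_insert_if)
  then show
    "color_seq (Suc 0) c w B [c, w] \<longleftrightarrow> c < 4 \<and> w < 4 \<and> c \<noteq> w \<and> c \<notin> B"
    "color_seq 2 c w B [c, x, w] \<longleftrightarrow> c < 4 \<and> x < 4 \<and> w < 4 \<and> c \<noteq> w \<and> c \<noteq> x \<and> x \<noteq> w \<and> x \<notin> B"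
    "color_seq 3 c w B [c, x, y, w] \<longleftrightarrow> c < 4 \<and> x < 4 \<and> y < 4 \<and> w < 4 \<and>
       c \<noteq> x \<and> c \<noteq> y \<and> x \<noteq> y \<and> x \<noteq> w \<and> y \<noteq> w \<and> y \<notin> B"
    "color_seq 4 c w B [c, x, y, z, w] \<longleftrightarrow> c < 4 \<and> x < 4 \<and> y < 4 \<and> z < 4 \<and> w < 4 \<and>
       c \<noteq> x \<and> c \<noteq> y \<and> x \<noteq> y \<and> x \<noteq> z \<and> y \<noteq> z \<and> y \<noteq> w \<and> z \<noteq> w \<and> z \<notin> B"
    unfolding color_seq_def by (simp; blast)+
qed

lemma four_colors:
  fixes w d :: nat
  assumes "w < 4" "d < 4" "w \<noteq> d"
  obtains x y where "x < 4" "y < 4" "distinct [w, d, x, y]"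
    "\<forall>c<4. c = w \<or> c = d \<or> c = x \<or> c = y"
proof -
  have "card ({..<4} - {w, d}) = 2" using assms by (subst card_Diff_subset) auto
  then obtain x y where "{..<4} - {w, d} = {x, y}" "x \<noteq> y" by (auto simp: card_2_iff)
  then show ?thesis using that[of x y] assms by (auto simp: set_eq_iff)
qed

text \<open>The colors \<open>c\<close> of the center for which a thread of \<open>n - 1\<close> 2-vertices, ending at a vertex
  of color \<open>w\<close> whose odd color is \<open>d\<close>, has no coloring.\<close>

definition forbidden :: "nat \<Rightarrow> nat \<Rightarrow> nat \<Rightarrow> nat set" where
  "forbidden n w d = (if n = 1 then {w, d} else if n = 2 then {w} else {})"

text \<open>Bounds the number of forbidden colors independently of \<open>w\<close> and
  \<open>d\<close>, so it can be read off the graph before anything is colored.\<close>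

definition weight :: "nat \<Rightarrow> nat" where
  "weight n = (if n = 1 then 2 else if n = 2 then 1 else 0)"

lemma card_forbidden: "card (forbidden n w d) \<le> weight n" "finite (forbidden n w d)"
  by (auto simp: forbidden_def weight_def card_insert_if)

text \<open>Besides \<open>w\<close> and \<open>d\<close> there are two colors \<open>x\<close> and
  \<open>y\<close>, and the last thread vertex, if there is one, always takes one of these. With two
  or three thread vertices the others can be filled in for every \<open>c\<close>; with one it is
  enough that \<open>c\<close> differs from \<open>w\<close>.\<close>

lemma color_seq_exists:
  assumes "1 \<le> n" "n \<le> 4" "w < 4" "d < 4" "w \<noteq> d" "B \<subseteq> {d}" "c < 4" "c \<notin> forbidden n w d"
  shows "\<exists>L. color_seq n c w B L"
proof -
  obtain x y where xy: "x < 4" "y < 4" "distinct [w, d, x, y]"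
    "\<forall>c<4. c = w \<or> c = d \<or> c = x \<or> c = y" by (rule four_colors[OF assms(3-5)])
  have B: "w \<notin> B" "x \<notin> B" "y \<notin> B" using xy(3) assms(5,6) by auto
  consider "n = Suc 0" | "n = 2" | "n = 3" | "n = 4" using assms by linarith
  then show ?thesis
  proof cases
    case 1
    then have "color_seq n c w B [c, w]"
      using assms by (auto simp: color_seq_simps forbidden_def)
    then show ?thesis by blast
  next
    case 2
    then have "c \<noteq> w" using assms by (simp add: forbidden_def)
    then have "color_seq n c w B [c, if c = x then y else x, w]"
      using assms(3-7) xy(1-3) B 2 by (auto simp: color_seq_simps)
    then show ?thesis by blast
  next
    case 3
    then have "n = 3" .
    consider "c = w" | "c = d" | "c = x" | "c = y" using xy(4) assms(7) by blast
    then show ?thesis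
    proof cases
      case 1
      then have "color_seq n c w B [c, x, y, w]"
        using \<open>n = 3\<close> assms(3-7) xy(1-3) B by (simp add: color_seq_simps eq_commute)
      then show ?thesis by blast
    next
      case 2
      then have "color_seq n c w B [c, x, y, w]"
        using \<open>n = 3\<close> assms(3-7) xy(1-3) B by (simp add: color_seq_simps eq_commute)
      then show ?thesis by blast
    next
      case 3
      then have "color_seq n c w B [c, d, y, w]"
        using \<open>n = 3\<close> assms(3-7) xy(1-3) B by (simp add: color_seq_simps eq_commute)
      then show ?thesis by blast
    next
      case 4
      then have "color_seq n c w B [c, d, x, w]"
        using \<open>n = 3\<close> assms(3-7) xy(1-3) B by (simp add: color_seq_simps eq_commute)
      then show ?thesis by blast
    qed
  next
    case 4
    then have "n = 4" .
    consider "c = w" | "c = d" | "c = x" | "c = y" using xy(4) assms(7) by blast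
    then show ?thesis
    proof cases
      case 1
      then have "color_seq n c w B [c, d, x, y, w]"
        using \<open>n = 4\<close> assms(3-7) xy(1-3) B by (simp add: color_seq_simps eq_commute)
      then show ?thesis by blast
    next
      case 2
      then have "color_seq n c w B [c, w, x, y, w]"
        using \<open>n = 4\<close> assms(3-7) xy(1-3) B by (simp add: color_seq_simps eq_commute)
      then show ?thesis by blast
    next
      case 3
      then have "color_seq n c w B [c, w, d, x, w]"
        using \<open>n = 4\<close> assms(3-7) xy(1-3) B by (simp add: color_seq_simps eq_commute)
      then show ?thesis by blast
    next
      case 4
      then have "color_seq n c w B [c, w, d, y, w]"
        using \<open>n = 4\<close> assms(3-7) xy(1-3) B by (simp add: color_seq_simps eq_commute)
      then show ?thesis by blast
    qed
  qed
qed

text \<open>Two colorings that differ next to the center let it repair its own parity. For three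
  thread vertices \<open>c = d\<close> is left out because it may force the first color: if
  \<open>d\<close> is protected, the last vertex takes \<open>x\<close> or \<open>y\<close>, the
  middle one the other of these, and only \<open>w\<close> remains for the first.\<close>

lemma color_seq_two:
  assumes "w < 4" "d < 4" "w \<noteq> d" "B \<subseteq> {d}" "c < 4"
    and "n = 4 \<and> c \<noteq> d \<or> n = 3 \<and> c = w \<or> n = 2 \<and> B = {} \<and> c \<noteq> w"
  shows "\<exists>L L'. color_seq n c w B L \<and> color_seq n c w B L' \<and> L ! 1 \<noteq> L' ! 1"
proof -
  obtain x y where xy: "x < 4" "y < 4" "distinct [w, d, x, y]"
    "\<forall>c<4. c = w \<or> c = d \<or> c = x \<or> c = y" by (rule four_colors[OF assms(1-3)])
  have B: "w \<notin> B" "x \<notin> B" "y \<notin> B" using xy(3) assms(3,4) by auto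
  from assms(6) consider "n = 4" "c \<noteq> d" | "n = 3" "c = w" | "n = 2" "B = {}" "c \<noteq> w" by blast
  then show ?thesis
  proof cases
    case 1
    then consider "c = w" | "c = x" | "c = y" using xy assms(1-5) by blast
    then show ?thesis
    proof cases
      case 1
      then show ?thesis using \<open>n = 4\<close> assms(1-5) xy(1-3) B
        by (intro exI[of _ "[c, d, x, y, w]"] exI[of _ "[c, x, d, y, w]"])
          (auto simp: color_seq_simps)
    next
      case 2
      then show ?thesis using \<open>n = 4\<close> assms(1-5) xy(1-3) B
        by (intro exI[of _ "[c, w, d, x, w]"] exI[of _ "[c, y, d, x, w]"])
          (auto simp: color_seq_simps)
    next
      case 3
      then show ?thesis using \<open>n = 4\<close> assms(1-5) xy(1-3) B
        by (intro exI[of _ "[c, w, d, y, w]"] exI[of _ "[c, x, d, y, w]"])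
          (auto simp: color_seq_simps)
    qed
  next
    case 2
    then show ?thesis using assms(1-5) xy(1-3) B
      by (intro exI[of _ "[c, d, x, w]"] exI[of _ "[c, x, y, w]"]) (auto simp: color_seq_simps)
  next
    case 3
    have "color_seq n c w B [c, if c = x then y else x, w]"
      "color_seq n c w B [c, if c = d then y else d, w]"
      using assms(1-5) xy(1-3) 3 by (auto simp: color_seq_simps)
    moreover have "(if c = x then y else x) \<noteq> (if c = d then y else d)"
      using xy(3) by auto
    ultimately show ?thesis
      by (intro exI[of _ "[c, if c = x then y else x, w]"]
          exI[of _ "[c, if c = d then y else d, w]"]) simp
  qed
qed

section \<open>Reducible stars of threads\<close>

lemma last_butlast_conv_nth:
  assumes "length xs = Suc (Suc n)"
  shows "last (butlast xs) = xs ! n"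
proof -
  have "butlast xs \<noteq> []" using assms by (cases xs) auto
  then have "last (butlast xs) = butlast xs ! n" using assms by (simp add: last_conv_nth)
  then show ?thesis using assms by (simp add: nth_butlast)
qed

text \<open>\<open>p a\<close> lists the thread starting at the neighbor \<open>a\<close>, and its
  last entry is the kept end, of any degree. Four entries allow three 2-vertices. Two threads joined
  at \<open>v\<close> form a walk of at most nine vertices, where a repetition would give a cycle
  shorter than 9.\<close>

locale thread_star =
  fixes V :: "'a set" and E :: "'a set set" and v :: 'a and p :: "'a \<Rightarrow> 'a list"
  assumes graph: "simple_graph V E" and v: "v \<in> V"
    and long: "\<And>vs. is_cycle E vs \<Longrightarrow> 9 \<le> length vs"
    and p_hd: "\<And>a. a \<in> neighborhood E v \<Longrightarrow> p a \<noteq> [] \<and> hd (p a) = a"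
    and walk: "\<And>a. a \<in> neighborhood E v \<Longrightarrow> nbwalk E (v # p a)"
    and len: "\<And>a. a \<in> neighborhood E v \<Longrightarrow> length (p a) \<le> 4"
    and deg2: "\<And>a x. a \<in> neighborhood E v \<Longrightarrow> x \<in> set (butlast (p a)) \<Longrightarrow>
      card (neighborhood E x) = 2"
begin

abbreviation "N \<equiv> neighborhood E"

definition S :: "'a set" where
  "S = insert v (\<Union>a\<in>N v. set (butlast (p a)))"

lemmas finN = finite_neighborhood[OF graph]

lemma short_distinct:
  assumes "nbwalk E xs" "length xs \<le> 9"
  shows "distinct xs"
proof (rule ccontr)
  assume "\<not> distinct xs"
  moreover have "card e = 2" if "e \<in> E" for e using graph that by (simp add: simple_graph_def)
  ultimately obtain vs where "is_cycle E vs" "length vs < length xs"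
    using nbwalk_cycle[of E xs] assms(1) by metis
  then show False using long[of vs] assms(2) by simp
qed

lemma distinct_thread: "a \<in> N v \<Longrightarrow> distinct (v # p a)"
  using walk len[of a] by (intro short_distinct) auto

lemma disjoint_threads:
  assumes "a \<in> N v" "b \<in> N v" "a \<noteq> b"
  shows "set (p a) \<inter> set (p b) = {}"
proof -
  have "nbwalk E (rev (p a) @ v # p b)"
    using assms p_hd walk by (intro nbwalk_join) auto
  then have "distinct (rev (p a) @ v # p b)"
    using len[OF assms(1)] len[OF assms(2)] by (intro short_distinct) auto
  then show ?thesis by auto
qed

lemma thread_unique: "a \<in> N v \<Longrightarrow> b \<in> N v \<Longrightarrow> x \<in> set (p a) \<Longrightarrow> x \<in> set (p b) \<Longrightarrow> a = b"
  using disjoint_threads by blast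

lemma set_butlast_conv: "x \<in> set (butlast xs) \<longleftrightarrow> (\<exists>i. Suc i < length xs \<and> x = xs ! i)"
  by (auto simp: in_set_conv_nth nth_butlast less_diff_conv)

lemma S_cases:
  assumes "x \<in> S"
  obtains "x = v" | a i where "a \<in> N v" "Suc i < length (p a)" "x = p a ! i"
  using assms by (auto simp: S_def set_butlast_conv)

lemma interior_S: "a \<in> N v \<Longrightarrow> Suc i < length (p a) \<Longrightarrow> p a ! i \<in> S"
  by (auto simp: S_def set_butlast_conv)

lemma neighborhood_interior:
  assumes "a \<in> N v" "Suc i < length (p a)"
  shows "N (p a ! i) = {(v # p a) ! i, p a ! Suc i}" "(v # p a) ! i \<noteq> p a ! Suc i"
proof -
  have "{(v # p a) ! i, (v # p a) ! Suc i} \<in> E" "{(v # p a) ! Suc i, (v # p a) ! Suc (Suc i)} \<in> E"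
    using nbwalk_nth(1)[OF walk[OF assms(1)], of i] nbwalk_nth(1)[OF walk[OF assms(1)], of "Suc i"]
      assms(2) by simp_all
  then have sub: "{(v # p a) ! i, p a ! Suc i} \<subseteq> N (p a ! i)"
    by (simp add: neighborhood_def insert_commute)
  show ne: "(v # p a) ! i \<noteq> p a ! Suc i"
    using nbwalk_nth(2)[OF walk[OF assms(1)], of i] assms(2) by simp
  have "card (N (p a ! i)) = 2" using deg2[OF assms(1)] assms(2) by (auto simp: set_butlast_conv)
  then have "{(v # p a) ! i, p a ! Suc i} = N (p a ! i)"
    using ne by (intro card_subset_eq[OF finN sub]) simp
  then show "N (p a ! i) = {(v # p a) ! i, p a ! Suc i}" by simp
qed

lemma last_thread: "a \<in> N v \<Longrightarrow> last (p a) \<in> set (p a)"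
  using p_hd by simp

lemma last_notin_S:
  assumes "a \<in> N v"
  shows "last (p a) \<notin> S"
proof
  assume "last (p a) \<in> S"
  then show False
  proof (cases rule: S_cases)
    case 1
    then show False using distinct_thread[OF assms] last_thread[OF assms] by auto
  next
    case (2 b i)
    then have "last (p a) \<in> set (p b)" by simp
    then have "b = a" using thread_unique[OF 2(1) assms] last_thread[OF assms] by blast
    moreover have "p a ! i = p a ! (length (p a) - 1)"
      using 2(3) \<open>b = a\<close> p_hd[OF assms] by (simp add: last_conv_nth)
    ultimately have "i = length (p a) - 1"
      using nth_eq_iff_index_eq[of "p a" i "length (p a) - 1"] distinct_thread[OF assms] 2(2) by simp
    then show False using 2(2) \<open>b = a\<close> by simp
  qed
qed

text \<open>Writing \<open>v # p a\<close> covers threads without 2-vertices, where the removed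
  neighbor of the end is \<open>v\<close> itself. As threads are disjoint, a kept vertex has at most
  one removed neighbor.\<close>

lemma outer_neighbor:
  assumes "u \<notin> S" "s \<in> N u" "s \<in> S"
  obtains a where "a \<in> N v" "u = last (p a)" "s = last (butlast (v # p a))"
  using assms(3)
proof (cases rule: S_cases)
  case 1
  then have u: "u \<in> N v" using assms(2) neighborhood_sym by metis
  then have "u = p u ! 0" using p_hd[OF u] hd_conv_nth[of "p u"] by simp
  then have "\<not> Suc 0 < length (p u)" using interior_S[OF u] assms(1) by metis
  then have "length (p u) = 1" using p_hd[OF u] by (cases "p u") auto
  then have "p u = [u]" using p_hd[OF u] by (cases "p u") auto
  then show ?thesis using that[OF u] 1 by simp
next
  case (2 a i)
  have ne: "p a \<noteq> []" using p_hd 2 by simp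
  have "u \<in> N (p a ! i)" using assms(2) 2(3) neighborhood_sym by metis
  then consider "u = (v # p a) ! i" | "u = p a ! Suc i"
    using neighborhood_interior[OF 2(1,2)] by auto
  then have u: "u = p a ! Suc i"
  proof cases
    case 1
    then have "u \<in> S"
      using 2 interior_S[of a "i - 1"] by (cases i) (auto simp: S_def)
    then show ?thesis using assms(1) by simp
  qed
  then have "\<not> Suc (Suc i) < length (p a)" using interior_S[OF 2(1)] assms(1) by metis
  then have i: "Suc (Suc i) = length (p a)" using 2(2) by simp
  have "u = last (p a)" using u ne i by (simp add: last_conv_nth flip: i)
  moreover have "s = last (butlast (v # p a))"
  proof -
    obtain ys y where ys: "p a = ys @ [y]" using ne by (cases "p a" rule: rev_cases) auto
    then have "length ys = Suc i" using i by simp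
    then have "ys \<noteq> []" by auto
    then have "last ys = ys ! i" using \<open>length ys = Suc i\<close> by (simp add: last_conv_nth)
    then show ?thesis using 2(3) ys \<open>length ys = Suc i\<close> \<open>ys \<noteq> []\<close> by (simp add: nth_append)
  qed
  ultimately show ?thesis using that 2(1) by blast
qed

text \<open>An end of odd degree has an odd class by parity, so its color \<open>d a\<close> need
  not be avoided.\<close>

definition seqs :: "('a \<Rightarrow> nat) \<Rightarrow> ('a \<Rightarrow> nat) \<Rightarrow> nat \<Rightarrow> 'a \<Rightarrow> nat list set" where
  "seqs w d c a = {L. color_seq (length (p a)) c (w a)
     (if odd (card (N (last (p a)))) then {} else {d a}) L}"

text \<open>Two choices for the color of one neighbor of \<open>v\<close> suffice: the other neighbors are odd in
  number, so one of the color classes among them is odd, and one of the two choices keeps it.\<close>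

lemma pick_seqs:
  assumes "\<And>a. a \<in> N v \<Longrightarrow> seqs w d c a \<noteq> {}"
    and "odd (card (N v)) \<or> N v = {} \<or> (\<exists>a\<in>N v. \<exists>L\<in>seqs w d c a. \<exists>L'\<in>seqs w d c a. L ! 1 \<noteq> L' ! 1)"
  obtains L where "\<forall>a\<in>N v. L a \<in> seqs w d c a"
    "N v \<noteq> {} \<longrightarrow> (\<exists>k. odd (card {a \<in> N v. L a ! 1 = k}))"
proof -
  define L where "L a = (SOME L. L \<in> seqs w d c a)" for a
  have L: "L a \<in> seqs w d c a" if "a \<in> N v" for a
    unfolding L_def using assms(1)[OF that] by (simp add: some_in_eq)
  show ?thesis
  proof (cases "odd (card (N v)) \<or> N v = {}")
    case True
    then show ?thesis using that[of L] L odd_class[OF finN, of v "\<lambda>a. L a ! 1"] by blast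
  next
    case False
    then obtain a L1 L2 where a: "a \<in> N v" "L1 \<in> seqs w d c a" "L2 \<in> seqs w d c a" "L1 ! 1 \<noteq> L2 ! 1"
      using assms(2) by blast
    have "Suc (card (N v - {a})) = card (N v)" by (rule card_Suc_Diff1[OF finN a(1)])
    then have "odd (card (N v - {a}))" using False by (metis even_Suc)
    then obtain k where k: "odd (card {b \<in> N v - {a}. L b ! 1 = k})"
      using odd_class[of "N v - {a}" "\<lambda>a. L a ! 1"] finN by blast
    obtain L0 where L0: "L0 \<in> seqs w d c a" "L0 ! 1 \<noteq> k" using a by metis
    have "{b \<in> N v. (L(a := L0)) b ! 1 = k} = {b \<in> N v - {a}. L b ! 1 = k}" using L0(2) by auto
    then have "\<exists>k. odd (card {b \<in> N v. (L(a := L0)) b ! 1 = k})" using k by metis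
    moreover have "(L(a := L0)) b \<in> seqs w d c b" if "b \<in> N v" for b using L L0(1) that by simp
    ultimately show ?thesis using that by blast
  qed
qed

text \<open>Threads are disjoint and repeat no vertex, so each of their vertices determines its
  thread and position, and both uses of \<open>THE\<close> are well defined. Colors are shifted by
  one against \<open>p a\<close>, as \<open>L a\<close> begins with the color of
  \<open>v\<close>.\<close>

lemma glue:
  assumes "\<And>a. a \<in> N v \<Longrightarrow> length (L a) = Suc (length (p a))"
    and "\<And>a. a \<in> N v \<Longrightarrow> hd (L a) = c" "\<And>a. a \<in> N v \<Longrightarrow> last (L a) = f (last (p a))"
  obtains g where "g v = c" "\<forall>u. u \<notin> S \<longrightarrow> g u = f u"
    "\<forall>a\<in>N v. \<forall>i\<le>length (p a). g ((v # p a) ! i) = L a ! i"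
proof -
  define th where "th x = (THE a. a \<in> N v \<and> x \<in> set (p a))" for x
  define idx where "idx a x = (THE i. i < length (p a) \<and> p a ! i = x)" for a x
  define g where "g x = (if x = v then c else if x \<in> S then L (th x) ! Suc (idx (th x) x) else f x)" for x
  have th: "th x = a" if "a \<in> N v" "x \<in> set (p a)" for a x
    unfolding th_def using that thread_unique by (intro the_equality) blast+
  have idx: "idx a (p a ! i) = i" if "a \<in> N v" "i < length (p a)" for a i
    unfolding idx_def using that distinct_thread[OF that(1)]
    by (intro the_equality) (auto simp: nth_eq_iff_index_eq)
  have "g ((v # p a) ! i) = L a ! i" if a: "a \<in> N v" and i: "i \<le> length (p a)" for a i
  proof (cases i)
    case 0
    have "L a \<noteq> []" using assms(1)[OF a] by auto
    then show ?thesis using 0 assms(2)[OF a] by (simp add: g_def hd_conv_nth)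
  next
    case (Suc j)
    then have j: "j < length (p a)" using i by simp
    have "p a ! j \<noteq> v" using distinct_thread[OF a] j by auto
    show ?thesis
    proof (cases "Suc j < length (p a)")
      case True
      then show ?thesis
        using Suc j \<open>p a ! j \<noteq> v\<close> interior_S[OF a True] th[OF a nth_mem[OF j]] idx[OF a j]
        by (simp add: g_def)
    next
      case False
      then have len: "length (p a) = Suc j" using j by simp
      then have "p a ! j = last (p a)" by (metis diff_Suc_1 last_conv_nth list.size(3) nat.distinct(1))
      moreover have "L a ! i = last (L a)"
        using assms(1)[OF a] len Suc by (metis diff_Suc_1 last_conv_nth list.size(3) nat.distinct(1))
      ultimately show ?thesis
        using Suc last_notin_S[OF a] \<open>p a ! j \<noteq> v\<close> assms(3)[OF a] by (simp add: g_def)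
    qed
  qed
  then show ?thesis using that[of g] by (auto simp: g_def S_def)
qed

text \<open>Asking for \<open>choice\<close> at all admissible \<open>w\<close> and \<open>d\<close>
  separates the color lists from the graph; here they become the colors and the chosen odd colors of
  the thread ends.\<close>

lemma extend_coloring:
  assumes col: "odd_colorable (V - S) {e \<in> E. e \<inter> S = {}} 4"
    and choice: "\<And>w d. (\<And>a. a \<in> N v \<Longrightarrow> w a < 4 \<and> d a < 4 \<and> w a \<noteq> d a) \<Longrightarrow>
      \<exists>c<4. (\<forall>a\<in>N v. seqs w d c a \<noteq> {}) \<and> (odd (card (N v)) \<or> N v = {} \<or>
        (\<exists>a\<in>N v. \<exists>L\<in>seqs w d c a. \<exists>L'\<in>seqs w d c a. L ! 1 \<noteq> L' ! 1))"
  shows "odd_colorable V E 4"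
proof -
  let ?E = "{e \<in> E. e \<inter> S = {}}"
  obtain f where f: "odd_coloring (V - S) ?E 4 f" using col by (auto simp: odd_colorable_def)
  have f4: "f u < 4" if "u \<in> V - S" for u
    using f that by (auto simp: odd_coloring_def proper_coloring_def)
  define P where "P u k \<longleftrightarrow> k < 4 \<and> k \<noteq> f u \<and>
    (neighborhood ?E u \<noteq> {} \<longrightarrow> odd (card {x \<in> neighborhood ?E u. f x = k}))" for u k
  define d where "d u = (SOME k. P u k)" for u
  have ex_d: "\<exists>k. P u k"
    if u: "u \<in> V - S" for u
  proof (cases "neighborhood ?E u = {}")
    case True
    \<comment> \<open>A vertex left without neighbors has no odd color; any color other than
      \<open>f u\<close> serves and keeps \<open>w\<close> and \<open>d\<close> distinct.\<close>
    then show ?thesis by (intro exI[of _ "if f u = 0 then 1 else 0"]) (simp add: P_def)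
  next
    case False
    moreover have "neighborhood ?E u \<subseteq> N u" by (auto simp: neighborhood_def)
    then have "finite (neighborhood ?E u)" using finN finite_subset by blast
    ultimately have "card (neighborhood ?E u) > 0" by (simp add: card_gt_0_iff)
    then obtain k where k: "odd (card {x \<in> neighborhood ?E u. f x = k})"
      using f u unfolding odd_coloring_def by blast
    then have "{x \<in> neighborhood ?E u. f x = k} \<noteq> {}" by (metis card.empty even_zero)
    then obtain x where x: "{u, x} \<in> ?E" "f x = k" by (auto simp: neighborhood_def)
    then have "x \<in> V - S" using simple_graph_edge[OF graph, of u x] by auto
    then have "k < 4" using f4 x by blast
    moreover have "f u \<noteq> f x" using f x(1) by (auto simp: odd_coloring_def proper_coloring_def)
    ultimately show ?thesis using k x(2) by (intro exI[of _ k]) (simp add: P_def)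
  qed
  have d: "P u (d u)" if "u \<in> V - S" for u
    unfolding d_def by (rule someI_ex[OF ex_d[OF that]])
  define w where "w a = f (last (p a))" for a
  define d' where "d' a = d (last (p a))" for a
  have last_V: "last (p a) \<in> V - S" if a: "a \<in> N v" for a
  proof -
    have i: "Suc (length (p a) - 1) < length (v # p a)" using p_hd[OF a] by (cases "p a") auto
    have "last (p a) = p a ! (length (p a) - 1)" using p_hd[OF a] by (simp add: last_conv_nth)
    then have "last (p a) \<in> V"
      using nbwalk_nth(1)[OF walk[OF a] i] simple_graph_edge(3)[OF graph] by simp
    then show ?thesis using last_notin_S[OF a] by simp
  qed
  have "w a < 4 \<and> d' a < 4 \<and> w a \<noteq> d' a" if "a \<in> N v" for a
    using f4[OF last_V[OF that]] d[OF last_V[OF that]] by (auto simp: w_def d'_def P_def)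
  then obtain c where c: "c < 4" "\<And>a. a \<in> N v \<Longrightarrow> seqs w d' c a \<noteq> {}" "odd (card (N v)) \<or> N v = {} \<or>
        (\<exists>a\<in>N v. \<exists>L\<in>seqs w d' c a. \<exists>L'\<in>seqs w d' c a. L ! 1 \<noteq> L' ! 1)"
    using choice[of w d'] by blast
  obtain L where L': "\<forall>a\<in>N v. L a \<in> seqs w d' c a"
    "N v \<noteq> {} \<longrightarrow> (\<exists>k. odd (card {a \<in> N v. L a ! 1 = k}))"
    by (rule pick_seqs[OF c(2,3)])
  note L = L'[rule_format]
  have Ln: "length (L a) = Suc (length (p a))" "hd (L a) = c" "last (L a) = f (last (p a))"
    "set (L a) \<subseteq> {..<4}" "nbwalk {e. card e = 2} (L a)"
    "even (card (N (last (p a)))) \<Longrightarrow> last (butlast (L a)) \<noteq> d (last (p a))" if "a \<in> N v" for a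
    using L(1)[OF that] by (auto simp: seqs_def color_seq_def w_def d'_def split: if_splits)
  obtain g where g': "g v = c" "\<forall>u. u \<notin> S \<longrightarrow> g u = f u"
    "\<forall>a\<in>N v. \<forall>i\<le>length (p a). g ((v # p a) ! i) = L a ! i"
    by (rule glue[OF Ln(1-3)])
  note g = g'[rule_format]
  have step1: "L a ! i \<noteq> L a ! Suc i" if "a \<in> N v" "i < length (p a)" for a i
    using nbwalk_nth(1)[OF Ln(5)[OF that(1)], of i] that Ln(1)[OF that(1)] by auto
  have step2: "L a ! i \<noteq> L a ! Suc (Suc i)" if "a \<in> N v" "Suc i < length (p a)" for a i
    using nbwalk_nth(2)[OF Ln(5)[OF that(1)], of i] that Ln(1)[OF that(1)] by auto
  have g_p: "g (p a ! i) = L a ! Suc i" if "a \<in> N v" "i < length (p a)" for a i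
    using g(3)[OF that(1), of "Suc i"] that(2) by simp
  have g_N: "g a = L a ! 1" if "a \<in> N v" for a
    using g_p[OF that, of 0] p_hd[OF that] by (auto simp: hd_conv_nth)
  have "odd_coloring V E 4 g"
  proof (rule odd_coloring_extend[OF graph f refl _ g(2), where d = d])
    show "odd (card {x \<in> neighborhood ?E u. f x = d u})"
      if "u \<in> V - S" "neighborhood ?E u \<noteq> {}" for u using d[OF that(1)] that(2) by (simp add: P_def)
  next
    fix s assume "s \<in> S"
    then show "g s < 4"
    proof (cases rule: S_cases)
      case (2 a i)
      then have "L a ! Suc i \<in> set (L a)" using Ln(1) by (intro nth_mem) simp
      then show ?thesis using 2 g_p[OF 2(1), of i] Ln(4)[OF 2(1)] by auto
    qed (simp add: g c)
  next
    fix s x assume "s \<in> S" and sx: "{s, x} \<in> E"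
    from \<open>s \<in> S\<close> show "g s \<noteq> g x"
    proof (cases rule: S_cases)
      case 1
      then have x: "x \<in> N v" using sx by (simp add: neighborhood_def)
      then have "0 < length (p x)" using p_hd by simp
      then show ?thesis using step1[OF x, of 0] g(3)[OF x, of 0] g_N[OF x] 1 by simp
    next
      case (2 a i)
      then have "x \<in> N (p a ! i)" using sx by (simp add: neighborhood_def)
      then consider "x = (v # p a) ! i" | "x = p a ! Suc i"
        using neighborhood_interior[OF 2(1,2)] by auto
      then show ?thesis
      proof cases
        case 1
        then have "g x = L a ! i" using g(3)[OF 2(1), of i] 2(2) by simp
        then show ?thesis using step1[OF 2(1), of i] g_p[OF 2(1), of i] 2 by simp
      next
        case x: 2
        then show ?thesis
          using step1[OF 2(1), of "Suc i"] g_p[OF 2(1), of i] g_p[OF 2(1), of "Suc i"] 2 by simp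
      qed
    qed
  next
    fix s assume "s \<in> S" and ne: "N s \<noteq> {}"
    from \<open>s \<in> S\<close> show "\<exists>k. odd (card {x \<in> N s. g x = k})"
    proof (cases rule: S_cases)
      case 1
      have "{a \<in> N v. g a = k} = {a \<in> N v. L a ! 1 = k}" for k using g_N by auto
      then show ?thesis using L(2) ne 1 by simp
    next
      case (2 a i)
      let ?y = "(v # p a) ! i" and ?z = "p a ! Suc i"
      have "g ?y = L a ! i" "g ?z = L a ! Suc (Suc i)"
        using g(3)[OF 2(1), of i] g_p[OF 2(1), of "Suc i"] 2(2) by auto
      then have "g ?z \<noteq> g ?y" using step2[OF 2(1,2)] by simp
      \<comment> \<open>The two neighbors of a removed 2-vertex have different colors, so each color
        occurs once.\<close>
      then have "{x \<in> N s. g x = g ?y} = {?y}"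
        unfolding 2(3) neighborhood_interior(1)[OF 2(1,2)] by auto
      then show ?thesis by (metis card.empty card_insert_disjoint empty_iff finite.emptyI odd_one One_nat_def)
    qed
  next
    fix u assume u: "u \<in> V - S"
    show "N u \<inter> S = {} \<or> odd (card (N u)) \<or> (\<exists>s. N u \<inter> S = {s} \<and> g s \<noteq> d u)"
    proof (cases "N u \<inter> S = {} \<or> odd (card (N u))")
      case False
      then obtain s where s: "s \<in> N u" "s \<in> S" by auto
      obtain a where a: "a \<in> N v" "u = last (p a)" "s = last (butlast (v # p a))"
        using outer_neighbor[of u s] u s by blast
      have "s' = s" if s': "s' \<in> N u" "s' \<in> S" for s'
      proof -
        obtain b where b: "b \<in> N v" "u = last (p b)" "s' = last (butlast (v # p b))"
          using outer_neighbor[of u s'] u s' by blast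
        then have "b = a" using thread_unique[OF b(1) a(1)] last_thread a b by metis
        then show ?thesis using a b by simp
      qed
      then have "N u \<inter> S = {s}" using s by blast
      moreover have "s = (v # p a) ! (length (p a) - 1)"
        using a(3) last_butlast_conv_nth[of "v # p a" "length (p a) - 1"] p_hd[OF a(1)] by simp
      then have "g s = L a ! (length (p a) - 1)" using g(3)[OF a(1)] by simp
      moreover have "last (butlast (L a)) = L a ! (length (p a) - 1)"
        using last_butlast_conv_nth[of "L a" "length (p a) - 1"] Ln(1)[OF a(1)] p_hd[OF a(1)] by simp
      ultimately show ?thesis using Ln(6)[OF a(1)] False a(2) by auto
    qed auto
  qed
  then show ?thesis by (auto simp: odd_colorable_def)
qed

text \<open>For a center of odd degree or without neighbors one allowed color is enough. Otherwise
  some thread must be switchable. One 2-vertex before an end of odd degree is switchable at every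
  allowed color. Three 2-vertices require the center to avoid \<open>d a\<close> too, lowering the
  budget to 2. Two 2-vertices are handled by giving the center the color \<open>w a\<close>, so
  nothing may be forbidden.\<close>

lemma reducible:
  assumes col: "odd_colorable (V - S) {e \<in> E. e \<inter> S = {}} 4"
    and w: "(\<Sum>a\<in>N v. weight (length (p a))) \<le> 3 \<and> (odd (card (N v)) \<or> N v = {} \<or>
        (\<exists>a\<in>N v. length (p a) = 2 \<and> odd (card (N (last (p a)))))) \<or>
      (\<Sum>a\<in>N v. weight (length (p a))) \<le> 2 \<and> (\<exists>a\<in>N v. length (p a) = 4) \<or>
      (\<Sum>a\<in>N v. weight (length (p a))) = 0 \<and> (\<exists>a\<in>N v. length (p a) = 3)"
  shows "odd_colorable V E 4"
proof (rule extend_coloring[OF col])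
  fix w d :: "'a \<Rightarrow> nat"
  assume wd: "\<And>a. a \<in> N v \<Longrightarrow> w a < 4 \<and> d a < 4 \<and> w a \<noteq> d a"
  let ?W = "\<Sum>a\<in>N v. weight (length (p a))"
  define F where "F = (\<Union>a\<in>N v. forbidden (length (p a)) (w a) (d a))"
  have finF: "finite F" using finN card_forbidden(2) by (auto simp: F_def)
  have "card F \<le> (\<Sum>a\<in>N v. card (forbidden (length (p a)) (w a) (d a)))"
    unfolding F_def by (rule card_UN_le[OF finN])
  also have "\<dots> \<le> ?W" by (rule sum_mono[OF card_forbidden(1)])
  finally have cardF: "card F \<le> ?W" .
  have pick: "\<exists>c<4. c \<notin> X" if "finite X" "card X \<le> 3" for X :: "nat set"
  proof (rule ccontr)
    assume "\<not> ?thesis"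
    then have "{..<4} \<subseteq> X" by auto
    then have "card {..<4::nat} \<le> card X" using that(1) by (intro card_mono)
    then show False using that(2) by simp
  qed
  let ?B = "\<lambda>a. if odd (card (N (last (p a)))) then {} else {d a}"
  have len1: "1 \<le> length (p a)" if "a \<in> N v" for a using p_hd[OF that] by (cases "p a") auto
  have ex: "seqs w d c a \<noteq> {}" if "c < 4" "c \<notin> F" "a \<in> N v" for c a
  proof -
    have "c \<notin> forbidden (length (p a)) (w a) (d a)" using that by (auto simp: F_def)
    then show ?thesis
      using color_seq_exists[of "length (p a)" "w a" "d a" "?B a" c] len1[OF that(3)] len[OF that(3)]
        wd[OF that(3)] that(1)
      by (auto simp: seqs_def)
  qed
  have two: "\<exists>L\<in>seqs w d c a. \<exists>L'\<in>seqs w d c a. L ! 1 \<noteq> L' ! 1"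
    if "c < 4" "a \<in> N v" "length (p a) = 4 \<and> c \<noteq> d a \<or> length (p a) = 3 \<and> c = w a \<or>
      length (p a) = 2 \<and> ?B a = {} \<and> c \<noteq> w a" for c a
    using color_seq_two[of "w a" "d a" "?B a" c "length (p a)"] wd[OF that(2)] that(1,3)
    by (auto simp: seqs_def)
  from w consider
    "?W \<le> 3" "odd (card (N v)) \<or> N v = {}"
    | a where "?W \<le> 3" "a \<in> N v" "length (p a) = 2" "odd (card (N (last (p a))))"
    | a where "?W \<le> 2" "a \<in> N v" "length (p a) = 4"
    | a where "?W = 0" "a \<in> N v" "length (p a) = 3" by blast
  then show "\<exists>c<4. (\<forall>a\<in>N v. seqs w d c a \<noteq> {}) \<and> (odd (card (N v)) \<or> N v = {} \<or>
        (\<exists>a\<in>N v. \<exists>L\<in>seqs w d c a. \<exists>L'\<in>seqs w d c a. L ! 1 \<noteq> L' ! 1))"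
  proof cases
    case 1
    then obtain c where "c < 4" "c \<notin> F" using pick[OF finF] cardF by auto
    then show ?thesis using ex 1(2) by blast
  next
    case (2 a)
    then obtain c where c: "c < 4" "c \<notin> F" using pick[OF finF] cardF by auto
    then have "c \<noteq> w a" using 2 by (auto simp: F_def forbidden_def)
    then show ?thesis using ex c two[of c a] 2 by auto
  next
    case (3 a)
    have "card (insert (d a) F) \<le> 3" using cardF 3(1) finF by (simp add: card_insert_if)
    then obtain c where c: "c < 4" "c \<notin> insert (d a) F" using pick[of "insert (d a) F"] finF by auto
    then show ?thesis using ex two[of c a] 3 by auto
  next
    case (4 a)
    then have "F = {}" using cardF finF by simp
    then show ?thesis using ex two[of "w a" a] 4 wd[OF 4(2)] by auto
  qed
qed

end

subsection \<open>Discharging\<close>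

lemma card_2_other:
  assumes "card A = 2" "x \<in> A"
  obtains y where "A = {x, y}" "x \<noteq> y"
proof -
  obtain a b where "A = {a, b}" "a \<noteq> b" using assms(1) by (auto simp: card_2_iff)
  then show ?thesis using that[of a] that[of b] assms(2) by auto
qed

text \<open>A pair is a directed edge, a dart from \<open>fst\<close> to \<open>snd\<close>. At a
  head of degree 2 the step to the other neighbor is forced; elsewhere the value is
  arbitrary.\<close>

definition nxt :: "'a set set \<Rightarrow> 'a \<times> 'a \<Rightarrow> 'a \<times> 'a" where
  "nxt E d = (snd d, SOME z. z \<in> neighborhood E (snd d) - {fst d})"

definition run :: "'a set set \<Rightarrow> 'a \<times> 'a \<Rightarrow> nat \<Rightarrow> bool" where
  "run E d k \<longleftrightarrow> (\<forall>i<k. card (neighborhood E (snd ((nxt E ^^ i) d))) = 2)"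

definition dart :: "'a set set \<Rightarrow> 'a \<times> 'a \<Rightarrow> bool" where
  "dart E d \<longleftrightarrow> snd d \<in> neighborhood E (fst d)"

lemma fst_nxt [simp]: "fst (nxt E d) = snd d"
  by (simp add: nxt_def)

lemma nxt_neighborhood:
  assumes "dart E d" "card (neighborhood E (snd d)) = 2"
  shows "neighborhood E (snd d) = {fst d, snd (nxt E d)}" "snd (nxt E d) \<noteq> fst d"
proof -
  have "fst d \<in> neighborhood E (snd d)" using assms(1) neighborhood_sym unfolding dart_def by metis
  then obtain z where z: "neighborhood E (snd d) = {fst d, z}" "fst d \<noteq> z"
    by (rule card_2_other[OF assms(2)])
  then have "(SOME z. z \<in> neighborhood E (snd d) - {fst d}) = z" by (intro some_equality) auto
  then have "snd (nxt E d) = z" by (simp add: nxt_def)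
  then show "neighborhood E (snd d) = {fst d, snd (nxt E d)}" "snd (nxt E d) \<noteq> fst d"
    using z by auto
qed

lemma dart_nxt: "dart E d \<Longrightarrow> card (neighborhood E (snd d)) = 2 \<Longrightarrow> dart E (nxt E d)"
  using nxt_neighborhood(1)[of E d] by (simp add: dart_def)

lemma nxt_back:
  assumes "dart E d" "card (neighborhood E (snd d)) = 2"
  shows "nxt E (prod.swap (nxt E d)) = prod.swap d"
proof -
  have "(SOME x. x \<in> neighborhood E (snd d) - {snd (nxt E d)}) = fst d"
    using nxt_neighborhood[OF assms] by (intro some_equality) auto
  moreover have "nxt E (z, snd d) = (snd d, SOME x. x \<in> neighborhood E (snd d) - {z})" for z
    by (simp add: nxt_def)
  moreover have "prod.swap (nxt E d) = (snd (nxt E d), snd d)" "prod.swap d = (snd d, fst d)"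
    by (simp_all add: prod_eq_iff)
  ultimately show ?thesis by (simp only:)
qed

lemma run_dart:
  assumes "dart E d" "run E d k" "i \<le> k"
  shows "dart E ((nxt E ^^ i) d)"
  using assms(3)
proof (induction i)
  case (Suc i)
  then show ?case using assms(2) dart_nxt[of E "(nxt E ^^ i) d"] by (simp add: run_def)
qed (simp add: assms)

lemma run_mono: "run E d k \<Longrightarrow> l \<le> k \<Longrightarrow> run E d l"
  by (simp add: run_def)

text \<open>Swapping a dart reverses the walk. On the way back the tail of \<open>d\<close>, itself
  a 2-vertex, is met as well, hence \<open>Suc j\<close>.\<close>

lemma run_swap:
  assumes "dart E d" "run E d j" "card (neighborhood E (fst d)) = 2"
  shows "(nxt E ^^ j) (prod.swap ((nxt E ^^ j) d)) = prod.swap d"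
    and "run E (prod.swap ((nxt E ^^ j) d)) (Suc j)"
proof -
  let ?d = "\<lambda>i. (nxt E ^^ i) d"
  have *: "(nxt E ^^ i) (prod.swap (?d j)) = prod.swap (?d (j - i))" if "i \<le> j" for i
    using that
  proof (induction i)
    case (Suc i)
    then obtain m where m: "j - i = Suc m" "m < j" by (cases "j - i") auto
    then have "(nxt E ^^ Suc i) (prod.swap (?d j)) = nxt E (prod.swap (nxt E (?d m)))"
      using Suc by simp
    also have "\<dots> = prod.swap (?d m)"
      using assms(2) m(2) run_dart[OF assms(1,2), of m] by (intro nxt_back) (auto simp: run_def)
    also have "m = j - Suc i" using m by simp
    finally show ?case .
  qed simp
  show "(nxt E ^^ j) (prod.swap (?d j)) = prod.swap d" using *[of j] by simp
  show "run E (prod.swap (?d j)) (Suc j)"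
    unfolding run_def
  proof (intro allI impI)
    fix i assume "i < Suc j"
    then have "snd ((nxt E ^^ i) (prod.swap (?d j))) = fst (?d (j - i))" using * by simp
    moreover have "card (neighborhood E (fst (?d (j - i)))) = 2"
      using assms(2,3) \<open>i < Suc j\<close> by (cases "j - i") (auto simp: run_def)
    ultimately show "card (neighborhood E (snd ((nxt E ^^ i) (prod.swap (?d j))))) = 2" by simp
  qed
qed

text \<open>\<open>t a\<close> may be smaller than the number of 2-vertices on the thread: cutting a
  thread short makes a 2-vertex its kept end. The end accounts for \<open>Suc (t a)\<close>.\<close>

lemma reducible_runs:
  assumes graph: "simple_graph V E" and v: "v \<in> V"
    and long: "\<And>vs. is_cycle E vs \<Longrightarrow> 9 \<le> length vs"
    and t: "\<And>a. a \<in> neighborhood E v \<Longrightarrow> t a \<le> 3 \<and> run E (v, a) (t a)"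
    and col: "\<And>S. v \<in> S \<Longrightarrow> odd_colorable (V - S) {e \<in> E. e \<inter> S = {}} 4"
    and w: "(\<Sum>a\<in>neighborhood E v. weight (Suc (t a))) \<le> 3 \<and>
        (odd (card (neighborhood E v)) \<or> neighborhood E v = {} \<or>
        (\<exists>a\<in>neighborhood E v. t a = 1 \<and> odd (card (neighborhood E (snd ((nxt E ^^ 1) (v, a))))))) \<or>
      (\<Sum>a\<in>neighborhood E v. weight (Suc (t a))) \<le> 2 \<and> (\<exists>a\<in>neighborhood E v. t a = 3) \<or>
      (\<Sum>a\<in>neighborhood E v. weight (Suc (t a))) = 0 \<and> (\<exists>a\<in>neighborhood E v. t a = 2)"
  shows "odd_colorable V E 4"
proof -
  define p where "p a = map (\<lambda>i. snd ((nxt E ^^ i) (v, a))) [0..<Suc (t a)]" for a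
  have len_p: "length (p a) = Suc (t a)" for a by (simp add: p_def)
  have nth_p: "p a ! i = snd ((nxt E ^^ i) (v, a))" if "i \<le> t a" for a i
    using that unfolding p_def by (subst nth_map) (auto simp del: upt_Suc)
  have fst_p: "(v # p a) ! i = fst ((nxt E ^^ i) (v, a))" if "i \<le> Suc (t a)" for a i
    using that nth_p[of "i - 1" a] by (cases i) auto
  interpret thread_star V E v p
  proof
    fix a assume a: "a \<in> neighborhood E v"
    then have dart: "dart E (v, a)" by (simp add: dart_def)
    have darts: "dart E ((nxt E ^^ i) (v, a))" if "i \<le> t a" for i
      using run_dart[OF dart] t[OF a] that by blast
    have "p a \<noteq> []" using len_p[of a] by auto
    then show "p a \<noteq> [] \<and> hd (p a) = a" using nth_p[of 0 a] by (simp add: hd_conv_nth)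
    show "length (p a) \<le> 4" using len_p[of a] t[OF a] by simp
    show "nbwalk E (v # p a)"
    proof (rule nbwalkI)
      fix i assume "Suc i < length (v # p a)"
      then have i: "i \<le> t a" using len_p[of a] by simp
      then show "{(v # p a) ! i, (v # p a) ! Suc i} \<in> E"
        using darts[OF i] fst_p[of i a] nth_p[OF i] by (simp add: dart_def neighborhood_def)
    next
      fix i assume "Suc (Suc i) < length (v # p a)"
      then have i: "i < t a" using len_p[of a] by simp
      then have "snd (nxt E ((nxt E ^^ i) (v, a))) \<noteq> fst ((nxt E ^^ i) (v, a))"
        using t[OF a] darts[of i] by (intro nxt_neighborhood(2)) (auto simp: run_def)
      then show "(v # p a) ! i \<noteq> (v # p a) ! Suc (Suc i)"
        using i fst_p[of i a] nth_p[of "Suc i" a] by simp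
    qed
    fix x assume "x \<in> set (butlast (p a))"
    then obtain i where "i < t a" "x = p a ! i"
      using len_p[of a] by (auto simp: in_set_conv_nth nth_butlast)
    then show "card (neighborhood E x) = 2" using t[OF a] nth_p[of i a] by (simp add: run_def)
  qed (use graph v long in auto)
  have last_p: "last (p a) = snd ((nxt E ^^ t a) (v, a))" for a
  proof -
    have "p a \<noteq> []" using len_p[of a] by auto
    then show ?thesis using last_conv_nth[of "p a"] nth_p[of "t a" a] len_p[of a] by simp
  qed
  show ?thesis
  proof (rule reducible)
    show "odd_colorable (V - S) {e \<in> E. e \<inter> S = {}} 4" by (rule col) (simp add: S_def)
  qed (use w in \<open>auto simp: len_p last_p\<close>)
qed

text \<open>The number of 2-vertices on the thread, capped at 3. Runs are monotone, so the set is an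
  initial segment; as a cardinality it sums over darts to the size of the set \<open>X\<close> in
  \<open>two_vertices_bound\<close>.\<close>

definition thread_length :: "'a set set \<Rightarrow> 'a \<times> 'a \<Rightarrow> nat" where
  "thread_length E d = card {k \<in> {1..3}. run E d k}"

lemma thread_length:
  "thread_length E d \<le> 3" "run E d (thread_length E d)"
  "\<not> run E d k \<Longrightarrow> thread_length E d < k"
proof -
  have sub: "{k \<in> {1..3}. run E d k} \<subseteq> {1..3}" by auto
  from card_mono[OF _ sub] show "thread_length E d \<le> 3" by (simp add: thread_length_def)
  have "\<exists>m\<le>3. {k \<in> {1..3}. run E d k} = {1..m} \<and> run E d m"
  proof -
    define m where "m = Max {k \<in> {0..3}. run E d k}"
    have "0 \<in> {k \<in> {0..3}. run E d k}" by (simp add: run_def)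
    then have "m \<in> {k \<in> {0..3}. run E d k}" unfolding m_def by (intro Max_in) auto
    then have m: "m \<le> 3" "run E d m" by auto
    moreover have "k \<le> m" if "k \<in> {1..3}" "run E d k" for k
      unfolding m_def using that by (intro Max_ge) auto
    then have "{k \<in> {1..3}. run E d k} = {1..m}"
      using m(1) run_mono[OF m(2)] by auto
    ultimately show ?thesis by blast
  qed
  then obtain m where m: "m \<le> 3" "{k \<in> {1..3}. run E d k} = {1..m}" "run E d m" by blast
  then have "thread_length E d = m" by (simp add: thread_length_def)
  then show "run E d (thread_length E d)" using m by simp
  show "thread_length E d < k" if "\<not> run E d k"
    using that run_mono[OF m(3)] \<open>thread_length E d = m\<close> by (meson not_le)
qed

text \<open>Walking from a 2-vertex in either direction leads to a vertex of another degree, whose thread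
  back to the 2-vertex recovers it; so each 2-vertex is counted twice by the threads.\<close>

lemma two_vertices_bound:
  assumes graph: "simple_graph V E"
    and no_run: "\<And>x y. x \<in> V \<Longrightarrow> card (neighborhood E x) = 2 \<Longrightarrow> y \<in> neighborhood E x \<Longrightarrow> \<not> run E (x, y) 3"
  shows "2 * card {x \<in> V. card (neighborhood E x) = 2} \<le>
    (\<Sum>v\<in>{v \<in> V. card (neighborhood E v) \<noteq> 2}. \<Sum>a\<in>neighborhood E v. thread_length E (v, a))"
proof -
  let ?N = "neighborhood E"
  let ?A = "{x \<in> V. card (?N x) = 2}" and ?B = "{v \<in> V. card (?N v) \<noteq> 2}"
  define D where "D = (SIGMA v:?B. ?N v)"
  define X where "X = (SIGMA d:D. {k \<in> {1..3}. run E d k})"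
  \<comment> \<open>For \<open>(d, k)\<close> in \<open>X\<close> this dart starts at the
    \<open>k\<close>-th 2-vertex on the thread of \<open>d\<close> and points back along it.\<close>
  define \<phi> where "\<phi> = (\<lambda>(d, k). prod.swap ((nxt E ^^ (k - 1)) d))"
  have fin: "finite ?A" "finite ?B" "\<And>v. finite (?N v)"
    using simple_graph_finite[OF graph] finite_neighborhood[OF graph] by auto
  have finD: "finite D" using fin by (auto simp: D_def)
  have finX: "finite X" using finD by (auto simp: X_def)
  have "(SIGMA x:?A. ?N x) \<subseteq> \<phi> ` X"
  proof
    fix d assume "d \<in> (SIGMA x:?A. ?N x)"
    then have d: "fst d \<in> V" "card (?N (fst d)) = 2" "dart E d" by (auto simp: dart_def)
    then have "\<not> run E d 3" using no_run[of "fst d" "snd d"] by (simp add: dart_def)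
    let ?j = "thread_length E d"
    have j: "?j < 3" "run E d ?j" using thread_length(2) thread_length(3)[OF \<open>\<not> run E d 3\<close>] by blast+
    have "\<not> run E d (Suc ?j)"
    proof
      assume "run E d (Suc ?j)"
      then have "{1..Suc ?j} \<subseteq> {k \<in> {1..3}. run E d k}" using j(1) run_mono by fastforce
      then have "card {1..Suc ?j} \<le> ?j" unfolding thread_length_def by (intro card_mono) auto
      then show False by simp
    qed
    let ?e = "(nxt E ^^ ?j) d"
    have deg: "card (?N (snd ?e)) \<noteq> 2"
      using \<open>\<not> run E d (Suc ?j)\<close> j(2) unfolding run_def by (auto simp: less_Suc_eq)
    have "dart E ?e" by (rule run_dart[OF d(3) j(2)]) simp
    then have "fst ?e \<in> ?N (snd ?e)" using neighborhood_sym unfolding dart_def by metis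
    moreover have "snd ?e \<in> V"
      using \<open>dart E ?e\<close> neighborhood_subset[OF graph] by (auto simp: dart_def)
    ultimately have "prod.swap ?e \<in> D" using deg by (auto simp: D_def prod.swap_def)
    moreover have "run E (prod.swap ?e) (Suc ?j)" by (rule run_swap(2)[OF d(3) j(2) d(2)])
    \<comment> \<open>At most two 2-vertices lie ahead of the tail of \<open>d\<close>, so together
      with the tail the count stays within the cap 3.\<close>
    ultimately have "(prod.swap ?e, Suc ?j) \<in> X" using j(1) by (auto simp: X_def)
    moreover have "\<phi> (prod.swap ?e, Suc ?j) = d"
      using run_swap(1)[OF d(3) j(2) d(2)] by (simp add: \<phi>_def)
    ultimately show "d \<in> \<phi> ` X" by (metis image_eqI)
  qed
  then have "card (SIGMA x:?A. ?N x) \<le> card X" using finX by (meson surj_card_le)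
  moreover have "card (SIGMA x:?A. ?N x) = 2 * card ?A" using fin by (simp add: card_SigmaI)
  moreover have "card X = (\<Sum>d\<in>D. thread_length E d)"
    unfolding X_def thread_length_def using finD by (simp add: card_SigmaI)
  moreover have "\<dots> = (\<Sum>v\<in>?B. \<Sum>a\<in>?N v. thread_length E (v, a))"
    unfolding D_def using fin by (subst sum.Sigma) auto
  ultimately show ?thesis by simp
qed

section \<open>Balancing the charge\<close>

lemma sparse_reducible:
  assumes graph: "simple_graph V E" and "9 * card E < 11 * card V"
    and long: "\<And>vs. is_cycle E vs \<Longrightarrow> 9 \<le> length vs"
    and col: "\<And>v S. v \<in> V \<Longrightarrow> v \<in> S \<Longrightarrow> odd_colorable (V - S) {e \<in> E. e \<inter> S = {}} 4"
  shows "odd_colorable V E 4"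
proof (rule ccontr)
  assume not: "\<not> odd_colorable V E 4"
  let ?N = "neighborhood E" and ?t = "thread_length E"
  note finN = finite_neighborhood[OF graph]
  have irreducible: False
    if v: "v \<in> V" and vt: "\<And>a. a \<in> ?N v \<Longrightarrow> t a \<le> 3 \<and> run E (v, a) (t a)"
      and weights: "(\<Sum>a\<in>?N v. weight (Suc (t a))) \<le> 3 \<and> (odd (card (?N v)) \<or> ?N v = {} \<or>
        (\<exists>a\<in>?N v. t a = 1 \<and> odd (card (?N (snd ((nxt E ^^ 1) (v, a))))))) \<or>
      (\<Sum>a\<in>?N v. weight (Suc (t a))) \<le> 2 \<and> (\<exists>a\<in>?N v. t a = 3) \<or>
      (\<Sum>a\<in>?N v. weight (Suc (t a))) = 0 \<and> (\<exists>a\<in>?N v. t a = 2)" for v t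
  proof (rule notE[OF not], rule reducible_runs[OF graph v])
    show "9 \<le> length vs" if "is_cycle E vs" for vs using that by (rule long)
    show "t a \<le> 3 \<and> run E (v, a) (t a)" if "a \<in> ?N v" for a using that by (rule vt)
    show "odd_colorable (V - S) {e \<in> E. e \<inter> S = {}} 4" if "v \<in> S" for S
      using v that by (rule col)
  qed (rule weights)
  have run0: "run E d 0" for d by (simp add: run_def)
  \<comment> \<open>With all threads cut to length 0, a vertex of degree 0 or 1 has total weight 0
    or 2.\<close>
  have min_deg: "2 \<le> card (?N v)" if v: "v \<in> V" for v
  proof (rule ccontr)
    assume "\<not> ?thesis"
    then have "card (?N v) = 0 \<or> card (?N v) = 1" by linarith
    then show False
      using irreducible[of v "\<lambda>_. 0"] v run0 finN[of v] by (auto simp: weight_def)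
  qed
  \<comment> \<open>Centered at \<open>x\<close>, the thread of three 2-vertices weighs 0 and the
    other edge 2, within the budget for a thread with three 2-vertices.\<close>
  have no_run3: "\<not> run E (x, y) 3"
    if xy: "x \<in> V" "card (?N x) = 2" "y \<in> ?N x" for x y
  proof
    assume "run E (x, y) 3"
    obtain y' where y': "?N x = {y, y'}" "y \<noteq> y'" by (rule card_2_other[OF xy(2,3)])
    show False
    proof (rule irreducible[OF xy(1), of "\<lambda>a. if a = y then 3 else 0"])
      show "(if a = y then 3 else 0) \<le> (3::nat) \<and> run E (x, a) (if a = y then 3 else 0)" for a
        using run0 \<open>run E (x, y) 3\<close> by simp
    qed (use y' in \<open>auto simp: weight_def\<close>)
  qed
  \<comment> \<open>The reduction is centered at the second 2-vertex \<open>b\<close>: towards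
    \<open>a\<close> one 2-vertex leads to the odd vertex \<open>v\<close>, and the other edge is
    taken bare, for a weight of 1 + 2.\<close>
  have odd_thread: "\<not> run E (v, a) 2" if va: "v \<in> V" "odd (card (?N v))" "a \<in> ?N v" for v a
  proof
    assume run: "run E (v, a) 2"
    have dart: "dart E (v, a)" using va by (simp add: dart_def)
    define b where "b = snd (nxt E (v, a))"
    have a2: "card (?N a) = 2" and b2: "card (?N b) = 2"
      using run by (auto simp: run_def b_def less_2_cases_iff)
    have nxt_b: "nxt E (b, a) = (a, v)"
      using nxt_back[OF dart] a2 by (simp add: b_def nxt_def)
    have "dart E (nxt E (v, a))" using dart_nxt[OF dart] a2 by simp
    then have ab: "a \<in> ?N b" "b \<in> V"
      using neighborhood_subset[OF graph] neighborhood_sym[of b E a] by (auto simp: dart_def b_def)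
    obtain c where c: "?N b = {a, c}" "a \<noteq> c" by (rule card_2_other[OF b2 ab(1)])
    have "run E (b, a) 1" using a2 by (simp add: run_def)
    show False
    proof (rule irreducible[OF ab(2), of "\<lambda>x. if x = a then 1 else 0"])
      show "(if x = a then 1 else 0) \<le> (3::nat) \<and> run E (b, x) (if x = a then 1 else 0)" for x
        using run0 \<open>run E (b, a) 1\<close> by simp
    qed (use c nxt_b va(2) in \<open>auto simp: weight_def\<close>)
  qed
  let ?A = "{v \<in> V. card (?N v) = 2}" and ?B = "{v \<in> V. card (?N v) \<noteq> 2}"
  define T where "T v = (\<Sum>a\<in>?N v. ?t (v, a))" for v
  have fin: "finite V" using simple_graph_finite[OF graph] by simp
  have "V = ?A \<union> ?B" by auto
  then have split: "(\<Sum>v\<in>V. f v) = (\<Sum>v\<in>?A. f v) + (\<Sum>v\<in>?B. f v)" for f :: "'a \<Rightarrow> nat"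
    using fin sum.union_disjoint[of ?A ?B f] by auto
  let ?D = "\<Sum>v\<in>?B. 9 * card (?N v)"
  have "(\<Sum>v\<in>V. 9 * card (?N v)) = 18 * card E"
    using handshake[OF graph] by (simp flip: sum_distrib_left)
  moreover have "(\<Sum>v\<in>V. 9 * card (?N v)) = 18 * card ?A + ?D"
    using split[of "\<lambda>v. 9 * card (?N v)"] by simp
  moreover have "card V = card ?A + card ?B"
    using split[of "\<lambda>_. 1"] by simp
  moreover have "2 * card ?A \<le> (\<Sum>v\<in>?B. T v)"
    unfolding T_def by (rule two_vertices_bound[OF graph no_run3])
  \<comment> \<open>The density bound doubled reads
    \<open>18 * card ?A + ?D < 22 * card ?A + 22 * card ?B\<close>; the missing 4 per 2-vertex is at
    most twice the sum of \<open>T\<close>.\<close>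
  ultimately have "?D < 22 * card ?B + 2 * (\<Sum>v\<in>?B. T v)"
    using assms(2) by linarith
  then have charge: "?D < (\<Sum>v\<in>?B. 22 + 2 * T v)"
    by (simp add: sum.distrib sum_distrib_left mult.commute)
  have "\<not> (\<forall>v\<in>?B. 22 + 2 * T v \<le> 9 * card (?N v))"
  proof (intro notI)
    assume "\<forall>v\<in>?B. 22 + 2 * T v \<le> 9 * card (?N v)"
    then have "(\<Sum>v\<in>?B. 22 + 2 * T v) \<le> ?D" by (intro sum_mono) blast
    with charge show False by (meson not_le)
  qed
  then obtain v where v: "v \<in> V" "card (?N v) \<noteq> 2" "9 * card (?N v) < 22 + 2 * T v"
    by (auto simp: not_le)
  let ?W = "\<Sum>a\<in>?N v. weight (Suc (?t (v, a)))"
  have t: "?t (v, a) \<le> 3 \<and> run E (v, a) (?t (v, a))" for a using thread_length by blast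
  show False
  proof (cases "odd (card (?N v))")
    case True
    have t1: "?t (v, a) \<le> 1" if "a \<in> ?N v" for a
      using thread_length(3)[OF odd_thread[OF v(1) True that]] by simp
    then have "T v \<le> (\<Sum>a\<in>?N v. 1)" unfolding T_def by (rule sum_mono)
    then have "T v \<le> card (?N v)" by simp
    \<comment> \<open>From 9d < 22 + 2d. At degree 3 all three threads must then have length 1, of
      total weight 3.\<close>
    then have "card (?N v) = 2 \<or> card (?N v) = 3" using v(3) min_deg[OF v(1)] by linarith
    then have "card (?N v) = 3" using True by auto
    then have "3 \<le> T v" using v(3) by linarith
    then have one: "(\<Sum>a\<in>?N v. 1 - ?t (v, a)) = 0"
      using sum_subtractf_nat[of "?N v" "\<lambda>a. ?t (v, a)" "\<lambda>_. 1"] t1 \<open>card (?N v) = 3\<close>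
      by (simp add: T_def)
    have "?t (v, a) = 1" if "a \<in> ?N v" for a
    proof -
      have "1 - ?t (v, a) = 0" using one finN[of v] that by simp
      then show ?thesis using t1[OF that] by linarith
    qed
    then have "?W = (\<Sum>a\<in>?N v. 1)" by (intro sum.cong) (auto simp: weight_def)
    then show False
      using irreducible[OF v(1) t] True \<open>card (?N v) = 3\<close> by auto
  next
    case False
    have "T v \<le> (\<Sum>a\<in>?N v. 3)" unfolding T_def using t by (intro sum_mono) auto
    \<comment> \<open>From 9d < 22 + 6d; among even degrees other than 2 only 4 and 6
      survive.\<close>
    then have "3 * card (?N v) < 22" using v(3) by simp
    then have "card (?N v) \<in> {2, 3, 4, 5, 6, 7}" using min_deg[OF v(1)] by auto
    then have "card (?N v) = 4 \<or> card (?N v) = 6" using v(2) False by auto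
    then have d: "card (?N v) = 4 \<and> 8 \<le> T v \<or> card (?N v) = 6 \<and> 17 \<le> T v" using v(3) by auto
    show False
    proof (cases "\<exists>a\<in>?N v. ?t (v, a) = 3")
      case True
      \<comment> \<open>The summand is 6, 5, 4, 6 at lengths 0 to 3, so a large \<open>T v\<close>
        leaves little weight.\<close>
      have "(\<Sum>a\<in>?N v. 3 * weight (Suc (?t (v, a))) + 2 * ?t (v, a)) \<le> (\<Sum>a\<in>?N v. 6)"
        using t by (intro sum_mono) (auto simp: weight_def)
      then have "3 * ?W + 2 * T v \<le> 6 * card (?N v)"
        by (simp add: sum.distrib T_def sum_distrib_left)
      then have "?W \<le> 2" using d by auto
      then show False using irreducible[OF v(1) t] True by blast
    next
      case False
      have t2: "?t (v, a) \<le> 2" if "a \<in> ?N v" for a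
        using False t[of a] that by (auto simp: le_less)
      \<comment> \<open>The summand is 2 at each of the lengths 0, 1, 2; this excludes degree 6 and
        forces weight 0 at degree 4.\<close>
      then have "(\<Sum>a\<in>?N v. weight (Suc (?t (v, a))) + ?t (v, a)) \<le> (\<Sum>a\<in>?N v. 2)"
        by (intro sum_mono) (auto simp: weight_def dest!: t2)
      then have "?W + T v \<le> 2 * card (?N v)" by (simp add: sum.distrib T_def)
      then have W: "?W = 0" using d by auto
      have "?N v \<noteq> {}" using d by auto
      then obtain a where a: "a \<in> ?N v" by blast
      then have "weight (Suc (?t (v, a))) = 0" using W finN[of v] by simp
      then have "?t (v, a) = 2" using t2[OF a] by (auto simp: weight_def split: if_splits)
      then show False using irreducible[OF v(1) t] W a by blast
    qed
  qed
qed

section \<open>Induction on the number of vertices\<close>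

lemma plane_drawing_subgraph:
  assumes "plane_drawing V E p \<gamma>" "V' \<subseteq> V" "E' \<subseteq> E" "\<And>e. e \<in> E' \<Longrightarrow> e \<subseteq> V'"
  shows "plane_drawing V' E' p \<gamma>"
proof -
  have D: "inj_on p V"
    "\<And>e. e \<in> E \<Longrightarrow> arc (\<gamma> e) \<and> {pathstart (\<gamma> e), pathfinish (\<gamma> e)} = p ` e \<and>
      path_image (\<gamma> e) \<inter> p ` V = p ` e"
    "\<And>e e'. e \<in> E \<Longrightarrow> e' \<in> E \<Longrightarrow> e \<noteq> e' \<Longrightarrow>
      path_image (\<gamma> e) \<inter> path_image (\<gamma> e') = p ` (e \<inter> e')"
    using assms(1) by (simp_all add: plane_drawing_def)
  show ?thesis
    unfolding plane_drawing_def
  proof (intro conjI ballI impI)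
    show "inj_on p V'" using D(1) assms(2) by (rule inj_on_subset)
  next
    fix e assume "e \<in> E'"
    then have e: "e \<in> E" "e \<subseteq> V'" using assms(3,4) by auto
    show "arc (\<gamma> e)" "{pathstart (\<gamma> e), pathfinish (\<gamma> e)} = p ` e" using D(2)[OF e(1)] by simp_all
    have restrict: "A \<inter> Q = R \<Longrightarrow> R \<subseteq> Q' \<Longrightarrow> Q' \<subseteq> Q \<Longrightarrow> A \<inter> Q' = R" for A Q Q' R :: "complex set"
      by blast
    show "path_image (\<gamma> e) \<inter> p ` V' = p ` e"
      by (rule restrict[of _ "p ` V"]) (use D(2)[OF e(1)] e(2) assms(2) in auto)
  next
    fix e e' assume "e \<in> E'" "e' \<in> E'" "e \<noteq> e'"
    then show "path_image (\<gamma> e) \<inter> path_image (\<gamma> e') = p ` (e \<inter> e')"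
      using assms(3) by (intro D(3)) auto
  qed
qed

theorem corollary1p5:
  fixes V :: "'a set" and E :: "'a set set"
  assumes "simple_graph V E"
    and "planar V E"
    and "girth E \<ge> 11"
  shows "odd_colorable V E 4"
proof -
  obtain p \<gamma> where drawing: "plane_drawing V E p \<gamma>" using assms(2) by (auto simp: planar_def)
  have long: "11 \<le> length vs" if "is_cycle E vs" for vs
  proof -
    have "girth E \<le> enat (length vs)" unfolding girth_def using that by (intro Inf_lower) auto
    moreover have "enat 11 \<le> girth E" using assms(3) by (simp add: numeral_eq_enat)
    ultimately have "enat 11 \<le> enat (length vs)" by (rule order_trans[rotated])
    then show ?thesis by simp
  qed
  \<comment> \<open>The induction carries a drawing and a bound on cycle lengths in place of
    \<open>planar\<close> and \<open>girth\<close>; both restrict directly to subgraphs.\<close>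
  show ?thesis
    using assms(1) drawing long
  proof (induction "card V" arbitrary: V E rule: less_induct)
    case less
    show ?case
    proof (cases "V = {}")
      case True
      then have "E = {}" using less.prems(1) by (auto simp: simple_graph_def)
      then show ?thesis using True
        by (auto simp: odd_colorable_def odd_coloring_def proper_coloring_def)
    next
      case False
      interpret plane_graph V E p \<gamma> using less.prems by unfold_locales
      have "(11 - 2) * card E < 11 * card V" using False less.prems(3) by (intro edge_bound) auto
      then have sparse: "9 * card E < 11 * card V" by simp
      show ?thesis
      proof (rule sparse_reducible[OF less.prems(1) sparse])
        show "9 \<le> length vs" if "is_cycle E vs" for vs using less.prems(3)[OF that] by simp
        fix v S assume v: "v \<in> V" "v \<in> S"
        let ?E = "{e \<in> E. e \<inter> S = {}}"
        have "card (V - S) < card V" using v fin(1) by (intro psubset_card_mono) auto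
        moreover have "simple_graph (V - S) ?E" using less.prems(1) by (auto simp: simple_graph_def)
        moreover have "plane_drawing (V - S) ?E p \<gamma>"
          using less.prems(1) by (intro plane_drawing_subgraph[OF less.prems(2)]) (auto simp: simple_graph_def)
        moreover have "11 \<le> length vs" if "is_cycle ?E vs" for vs
          using less.prems(3) cycle_mono[OF that] by blast
        ultimately show "odd_colorable (V - S) ?E 4" by (rule less.hyps)
      qed
    qed
  qed
qed

end
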